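(* Let $q$ be an exponential factor, $r=\mathrm{ram}(q)$ and $\Theta=\langle q\rangle$. The cyclic group $\mathbb Z/r\mathbb Z$ acts freely on $\mathbf B([(1,q)])$ via $\sigma$, and the full local wild mapping class group $\overline\Gamma(\Theta)=\pi_1(\mathbf B([(1,q)])/(\mathbb Z/r\mathbb Z))$ is isomorphic to $\mathbb Z^{|\mathrm{Levels}(q)|}$. In particular the short exact sequence $0\to\mathbb Z^{|\mathrm{Levels}(q)|}\to\overline\Gamma(\Theta)\to\mathbb Z/r\mathbb Z\to0$ (with first term $\pi_1(\mathbf B([(1,q)]))$) does not split when $r>1$.
   Context: Exponential factors: finite sums $q=\sum_ka_kx^k$, $a_k\in\mathbb C$, $k\in\mathbb Q_{>0}$; $\mathrm{slope}(q)$ = largest exponent with nonzero coefficient ($0$ if $q=0$); $\mathrm{ram}(q)$ = least $r\ge1$ with $q\in x^{1/r}\mathbb C[x^{1/r}]$. Galois operator $\sigma(\sum a_kx^k)=\sum a_ke^{-2\pi\sqrt{-1}k}x^k$; Stokes circle $\langle q\rangle=\{\sigma^i(q)\}$. $\mathrm{Levels}(q)=\{\mathrm{slope}(q-\sigma^i(q)):i\in\mathbb Z\}\setminus\{0\}$. For $Q=[(1,q)]$, with $r=\mathrm{ram}(q)$, $K=\mathrm{slope}(q)$, $s=rK$: $\mathbf B(Q)=\{\mathbf a\in\mathbb C^s:\mathrm{slope}(\sigma^k(q_{\mathbf a})-\sigma^l(q_{\mathbf a}))=\mathrm{slope}(\sigma^k(q)-\sigma^l(q))\ \forall\,0\le k,l\le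 r\}$, where $q_{\mathbf a}=\sum_{j=1}^sa_jx^{j/r}$, with the subspace topology; $\mathbb Z/r\mathbb Z$ acts by $q_{\mathbf a}\mapsto\sigma(q_{\mathbf a})$. *)

theory Defs
  imports "HOL-Analysis.Analysis" "HOL-Algebra.Group_Action" "HOL-Algebra.Product_Groups"
          "HOL-Algebra.Elementary_Groups"
begin

text \<open>An exponential factor q = sum a_k x^k is represented by its coefficient function
  rat => complex (coefficient of x^k), with finite support contained in the positive rationals.\<close>

definition exp_factor :: "(rat \<Rightarrow> complex) \<Rightarrow> bool" where
  "exp_factor q \<longleftrightarrow> finite {k. q k \<noteq> 0} \<and> (\<forall>k. q k \<noteq> 0 \<longrightarrow> k > 0)"

definition slope :: "(rat \<Rightarrow> complex) \<Rightarrow> rat" where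
  "slope q = (if {k. q k \<noteq> 0} = {} then 0 else Max {k. q k \<noteq> 0})"

definition ram :: "(rat \<Rightarrow> complex) \<Rightarrow> nat" where
  "ram q = (LEAST r. r \<ge> 1 \<and> (\<forall>k. q k \<noteq> 0 \<longrightarrow> (\<exists>j::nat. j \<ge> 1 \<and> k = of_nat j / of_nat r)))"

definition sigma :: "(rat \<Rightarrow> complex) \<Rightarrow> (rat \<Rightarrow> complex)" where
  "sigma q = (\<lambda>k. exp (- (2 * of_real pi * imaginary_unit * of_real (of_rat k))) * q k)"

text \<open>Integer powers sigma^i (sigma is a bijection of rat => complex).\<close>
definition sigma_int :: "int \<Rightarrow> (rat \<Rightarrow> complex) \<Rightarrow> (rat \<Rightarrow> complex)" where
  "sigma_int i = (if i \<ge> 0 then sigma ^^ nat i else (inv_into UNIV sigma) ^^ nat (- i))"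

definition Levels :: "(rat \<Rightarrow> complex) \<Rightarrow> rat set" where
  "Levels q = {slope (\<lambda>k. q k - sigma_int i q k) | i. True} - {0}"

text \<open>s = r * slope q (a natural number).\<close>
definition sdim :: "(rat \<Rightarrow> complex) \<Rightarrow> nat" where
  "sdim q = nat \<lfloor>of_nat (ram q) * slope q\<rfloor>"

text \<open>Points a of C^s are represented as functions nat => complex vanishing outside {1..s};
  q_a = sum_{j=1}^s a_j x^(j/r).\<close>
definition q_of :: "nat \<Rightarrow> nat \<Rightarrow> (nat \<Rightarrow> complex) \<Rightarrow> (rat \<Rightarrow> complex)" where
  "q_of r s a = (\<lambda>k. if \<exists>j\<in>{1..s}. k = of_nat j / of_nat r
                      then a (THE j. j \<in> {1..s} \<and> k = of_nat j / of_nat r) else 0)"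

definition Bset :: "(rat \<Rightarrow> complex) \<Rightarrow> (nat \<Rightarrow> complex) set" where
  "Bset q = {a. (\<forall>j. j \<notin> {1..sdim q} \<longrightarrow> a j = 0) \<and>
      (\<forall>k\<in>{0..ram q}. \<forall>l\<in>{0..ram q}.
         slope (\<lambda>x. (sigma ^^ k) (q_of (ram q) (sdim q) a) x - (sigma ^^ l) (q_of (ram q) (sdim q) a) x)
       = slope (\<lambda>x. (sigma ^^ k) q x - (sigma ^^ l) q x))}"

text \<open>Subspace topology of C^s (product topology on the coordinates; coordinates outside
  {1..s} are identically 0 on Bset q).\<close>
definition Btop :: "(rat \<Rightarrow> complex) \<Rightarrow> (nat \<Rightarrow> complex) topology" where
  "Btop q = subtopology (product_topology (\<lambda>_. euclidean) UNIV) (Bset q)"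

text \<open>The generator of Z/rZ acts by q_a |-> sigma(q_a), i.e. a_j |-> e^(-2 pi i j/r) a_j.\<close>
definition sigma_coef :: "nat \<Rightarrow> (nat \<Rightarrow> complex) \<Rightarrow> (nat \<Rightarrow> complex)" where
  "sigma_coef r a = (\<lambda>j. exp (- (2 * of_real pi * imaginary_unit * of_nat j / of_nat r)) * a j)"

text \<open>Action of m in Z/rZ = {0..<r} on Bset q.\<close>
definition Bact :: "(rat \<Rightarrow> complex) \<Rightarrow> int \<Rightarrow> (nat \<Rightarrow> complex) \<Rightarrow> (nat \<Rightarrow> complex)" where
  "Bact q m = (\<lambda>a\<in>Bset q. (sigma_coef (ram q) ^^ nat m) a)"

definition quotient_topology :: "'a topology \<Rightarrow> ('a \<Rightarrow> 'b) \<Rightarrow> 'b topology" where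
  "quotient_topology X f =
     topology (\<lambda>U. U \<subseteq> f ` topspace X \<and> openin X {x \<in> topspace X. f x \<in> U})"

definition Bquot :: "(rat \<Rightarrow> complex) \<Rightarrow> (nat \<Rightarrow> complex) set topology" where
  "Bquot q = quotient_topology (Btop q) (orbit (integer_mod_group (ram q)) (Bact q))"

definition path_join :: "(real \<Rightarrow> 'a) \<Rightarrow> (real \<Rightarrow> 'a) \<Rightarrow> real \<Rightarrow> 'a" where
  "path_join g h = (\<lambda>t. if t \<le> 1/2 then g (2 * t) else h (2 * t - 1))"

definition loops_at :: "'a topology \<Rightarrow> 'a \<Rightarrow> (real \<Rightarrow> 'a) set" where
  "loops_at X x = {g. pathin X g \<and> g 0 = x \<and> g 1 = x}"

definition loop_class :: "'a topology \<Rightarrow> 'a \<Rightarrow> (real \<Rightarrow> 'a) \<Rightarrow> (real \<Rightarrow> 'a) set" where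
  "loop_class X x g = {h \<in> loops_at X x.
      homotopic_with (\<lambda>k. k 0 = x \<and> k 1 = x) (top_of_set {0..1}) X g h}"

definition fundamental_group :: "'a topology \<Rightarrow> 'a \<Rightarrow> (real \<Rightarrow> 'a) set monoid" where
  "fundamental_group X x =
     \<lparr>carrier = loop_class X x ` loops_at X x,
      monoid.mult = (\<lambda>A B. loop_class X x (path_join (SOME g. g \<in> A) (SOME g. g \<in> B))),
      one = loop_class X x (\<lambda>t. x)\<rparr>"

definition Zpow :: "nat \<Rightarrow> (nat \<Rightarrow> int) monoid" where
  "Zpow n = product_group {..<n} (\<lambda>_. integer_group)"

end

theory Submission
  imports Defs
begin

text \<open>
  In coordinates, the slope conditions say that \<open>\<^bold>B\<close> is a product of copies of \<open>\<complex>\<^sup>*\<close> (one for each level),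
  copies of \<open>\<complex>\<close> and points. Taking logarithms on the level coordinates exhibits a complex vector space
  covering both \<open>\<^bold>B\<close> and its quotient; loops are classified by the increments of the logarithms along
  lifts, which form \<open>\<int>\<^sup>L\<close> for \<open>\<^bold>B\<close> and the lattice \<open>\<int>\<^sup>L + \<int> (j/r)\<^sub>j\<close> for the quotient. Both are lattices of
  rank \<open>|L|\<close>. Minimality of the ramification makes the level exponents together with \<open>r\<close> coprime: this
  gives freeness of the action and, via Bezout, a monomial of weight one which is used to lift maps from
  the quotient to \<open>\<^bold>B\<close>. A section of the extension would embed \<open>\<int>/r\<close> in a torsion-free group.
\<close>

section \<open>Lattices of full rank\<close>

text \<open>Both spaces are treated by one argument: the space itself is the quotient by a group of
  order one, so a single locale is instantiated twice. The topological input is a lifting property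
  for maps of a square: maps constant in one variable give path lifting, general ones give homotopy
  invariance. The obstacle is that a lift through the quotient has to be chosen continuously.
  Instead of evenly covered neighbourhoods, invariant functions are used: they descend to the
  quotient and reduce the choice to an \<open>r\<close>-th root of a nowhere vanishing function on a
  contractible square, after which logarithms lead up to the vector space. There, lifts with common
  endpoints are joined by straight segments, which project to a homotopy of loops. The rank is exact
  because the lattice, scaled to integer entries, lies between \<open>r\<close> times all integer
  vectors on the level coordinates and all of them.\<close>

definition additive_group :: "('a \<Rightarrow> int) set \<Rightarrow> ('a \<Rightarrow> int) monoid" where
  "additive_group H = \<lparr>carrier = H, monoid.mult = (\<lambda>f g j. f j + g j), one = (\<lambda>_. 0)\<rparr>"

definition int_lattice :: "('a \<Rightarrow> int) set \<Rightarrow> bool" where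
  "int_lattice H \<longleftrightarrow> (\<lambda>_. 0) \<in> H \<and> (\<forall>f\<in>H. \<forall>g\<in>H. (\<lambda>j. f j - g j) \<in> H)"

lemma int_lattice_diff:
  "int_lattice H \<Longrightarrow> f \<in> H \<Longrightarrow> g \<in> H \<Longrightarrow> (\<lambda>j. f j - g j) \<in> H"
  by (simp add: int_lattice_def)

lemma int_lattice_add:
  assumes "int_lattice H" "f \<in> H" "g \<in> H"
  shows "(\<lambda>j. f j + g j) \<in> H"
proof -
  have "(\<lambda>j. 0 - g j) \<in> H"
    using assms by (auto simp: int_lattice_def)
  then have "(\<lambda>j. f j - (0 - g j)) \<in> H"
    by (rule int_lattice_diff[OF assms(1,2)])
  then show ?thesis by simp
qed

lemma int_lattice_scale:
  assumes "int_lattice H" "f \<in> H"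
  shows "(\<lambda>j. c * f j) \<in> H"
proof -
  have nat: "(\<lambda>j. int n * f j) \<in> H" for n
  proof (induction n)
    case 0
    then show ?case using assms by (auto simp: int_lattice_def)
  next
    case (Suc n)
    then have "(\<lambda>j. f j + int n * f j) \<in> H"
      using int_lattice_add[OF assms] by auto
    then show ?case by (simp add: algebra_simps)
  qed
  show ?thesis
  proof (cases "c \<ge> 0")
    case True
    then show ?thesis using nat[of "nat c"] by simp
  next
    case False
    have "(\<lambda>j. 0 - int (nat (-c)) * f j) \<in> H"
      by (rule int_lattice_diff[OF assms(1) _ nat]) (use assms in \<open>simp add: int_lattice_def\<close>)
    then show ?thesis using False by simp
  qed
qed

lemma int_lattice_sum:
  assumes "int_lattice H" "finite I" "\<And>i. i \<in> I \<Longrightarrow> b i \<in> H"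
  shows "(\<lambda>j. \<Sum>i\<in>I. c i * b i j) \<in> H"
  using assms(2,3)
proof (induction rule: finite_induct)
  case empty
  then show ?case using assms by (simp add: int_lattice_def)
next
  case (insert x F)
  then show ?case
    using int_lattice_add[OF assms(1) int_lattice_scale[OF assms(1), of "b x"], of "\<lambda>j. \<Sum>i\<in>F. c i * b i j"]
    by simp
qed

text \<open>Induction on coordinates: the values at \<open>k\<close> form an ideal
  \<open>d Z\<close>, and a vector attaining \<open>d\<close> splits \<open>H\<close> into the
  kernel of evaluation at \<open>k\<close> and a copy of the integers. The multiples of unit vectors
  make every such ideal nonzero, so each coordinate contributes exactly one basis vector.\<close>

lemma int_lattice_basis:
  fixes H :: "('a \<Rightarrow> int) set"
  assumes "finite M" "int_lattice H" "\<And>h j. h \<in> H \<Longrightarrow> j \<notin> M \<Longrightarrow> h j = 0"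
    and "r > 0" "\<And>k. k \<in> M \<Longrightarrow> (\<lambda>j. if j = k then r else 0) \<in> H"
  shows "\<exists>b. (\<forall>i < card M. b i \<in> H) \<and>
             (\<forall>h\<in>H. \<exists>c. h = (\<lambda>j. \<Sum>i<card M. c i * b i j)) \<and>
             (\<forall>c. (\<forall>j. (\<Sum>i<card M. c i * b i j) = 0) \<longrightarrow> (\<forall>i<card M. c i = 0))"
  using assms
proof (induction M arbitrary: H rule: finite_induct)
  case empty
  then show ?case by (auto simp: int_lattice_def fun_eq_iff)
next
  case (insert k M)
  note lat = insert.prems(1)
  let ?n = "card M"
  define K where "K = {h \<in> H. h k = 0}"
  define D where "D = {d::nat. d > 0 \<and> (\<exists>h\<in>H. h k = int d)}"
  have "nat r \<in> D"
    using insert.prems(3) insert.prems(4)[of k] by (auto simp: D_def intro!: bexI[of _ "\<lambda>j. if j = k then r else 0"])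
  define d where "d = (LEAST d. d \<in> D)"
  have "d \<in> D" unfolding d_def by (rule LeastI) fact
  then obtain h0 where h0: "h0 \<in> H" "h0 k = int d" and d: "d > 0"
    by (auto simp: D_def)
  have d_dvd: "int d dvd h k" if "h \<in> H" for h
  proof (rule ccontr)
    assume nd: "\<not> int d dvd h k"
    define h' where "h' = (\<lambda>j. h j - (h k div int d) * h0 j)"
    have "h' \<in> H"
      unfolding h'_def by (rule int_lattice_diff[OF lat that int_lattice_scale[OF lat h0(1)]])
    moreover have "h' k = h k mod int d"
      by (simp add: h'_def h0 minus_div_mult_eq_mod)
    moreover have "h k mod int d > 0"
      using nd d by (metis dvd_eq_mod_eq_0 of_nat_0_less_iff order_less_le pos_mod_sign)
    ultimately have "nat (h k mod int d) \<in> D"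
      by (auto simp: D_def intro!: bexI[of _ h'])
    then have "d \<le> nat (h k mod int d)"
      unfolding d_def by (rule Least_le)
    moreover have "h k mod int d < int d" using d by simp
    ultimately show False using \<open>h k mod int d > 0\<close> by linarith
  qed
  have latK: "int_lattice K"
    using lat by (auto simp: K_def int_lattice_def)
  have suppK: "h j = 0" if "h \<in> K" "j \<notin> M" for h j
    using that insert.prems(2)[of h j] by (cases "j = k") (auto simp: K_def)
  have deltaK: "(\<lambda>j. if j = l then r else 0) \<in> K" if "l \<in> M" for l
    using that insert.prems(4)[of l] insert.hyps by (auto simp: K_def)
  have "\<exists>b. (\<forall>i < ?n. b i \<in> K) \<and> (\<forall>h\<in>K. \<exists>c. h = (\<lambda>j. \<Sum>i<?n. c i * b i j)) \<and>
           (\<forall>c. (\<forall>j. (\<Sum>i<?n. c i * b i j) = 0) \<longrightarrow> (\<forall>i<?n. c i = 0))"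
    by (rule insert.IH) (fact latK suppK deltaK insert.prems(3))+
  then obtain b where b: "\<And>i. i < ?n \<Longrightarrow> b i \<in> K"
     "\<And>h. h \<in> K \<Longrightarrow> \<exists>c. h = (\<lambda>j. \<Sum>i<?n. c i * b i j)"
     "\<And>c. (\<forall>j. (\<Sum>i<?n. c i * b i j) = 0) \<Longrightarrow> (\<forall>i<?n. c i = 0)"
    by (elim exE conjE) blast
  define b' where "b' = b(?n := h0)"
  have sum': "(\<Sum>i<Suc ?n. c i * b' i j) = (\<Sum>i<?n. c i * b i j) + c ?n * h0 j" for c j
    by (simp add: b'_def)
  have card: "card (insert k M) = Suc ?n" using insert.hyps by simp
  show ?case
    unfolding card
  proof (intro exI[of _ b'] conjI ballI allI impI)
    fix i assume "i < Suc ?n"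
    then show "b' i \<in> H"
      using b(1)[of i] h0 by (cases "i = ?n") (auto simp: b'_def K_def)
  next
    fix h assume h: "h \<in> H"
    define m where "m = h k div int d"
    have "(\<lambda>j. h j - m * h0 j) \<in> H"
      by (rule int_lattice_diff[OF lat h int_lattice_scale[OF lat h0(1)]])
    moreover have "h k - m * h0 k = 0"
      using d_dvd[OF h] by (simp add: m_def h0)
    ultimately have "(\<lambda>j. h j - m * h0 j) \<in> K" by (simp add: K_def)
    then obtain c where c: "(\<lambda>j. h j - m * h0 j) = (\<lambda>j. \<Sum>i<?n. c i * b i j)"
      using b(2) by blast
    have "h = (\<lambda>j. \<Sum>i<Suc ?n. (c(?n := m)) i * b' i j)"
    proof
      fix j
      show "h j = (\<Sum>i<Suc ?n. (c(?n := m)) i * b' i j)"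
        using fun_cong[OF c, of j] unfolding sum' by simp
    qed
    then show "\<exists>c. h = (\<lambda>j. \<Sum>i<Suc ?n. c i * b' i j)" by blast
  next
    fix c i assume c: "\<forall>j. (\<Sum>i<Suc ?n. c i * b' i j) = 0" and i: "i < Suc ?n"
    \<comment> \<open>Evaluation at \<open>k\<close> kills the basis of the kernel and isolates the
      coefficient of \<open>h0\<close>.\<close>
    have "(\<Sum>i<?n. c i * b i k) = 0"
      using b(1) by (auto simp: K_def intro!: sum.neutral)
    then have cn: "c ?n = 0"
      using c[rule_format, of k] d h0 unfolding sum' by simp
    then have "\<forall>i<?n. c i = 0"
      using c b(3) unfolding sum' by simp
    then show "c i = 0" using cn i by (cases "i = ?n") auto
  qed
qed

lemma int_lattice_iso_Zpow:
  fixes H :: "('a \<Rightarrow> int) set"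
  assumes "finite M" "int_lattice H" "\<And>h j. h \<in> H \<Longrightarrow> j \<notin> M \<Longrightarrow> h j = 0"
    and "r > 0" "\<And>k. k \<in> M \<Longrightarrow> (\<lambda>j. if j = k then r else 0) \<in> H"
  shows "additive_group H \<cong> Zpow (card M)"
proof -
  let ?n = "card M"
  obtain b where b: "\<And>i. i < ?n \<Longrightarrow> b i \<in> H"
     "\<And>h. h \<in> H \<Longrightarrow> \<exists>c. h = (\<lambda>j. \<Sum>i<?n. c i * b i j)"
     "\<And>c. (\<forall>j. (\<Sum>i<?n. c i * b i j) = 0) \<Longrightarrow> (\<forall>i<?n. c i = 0)"
  proof -
    have "\<exists>b. (\<forall>i < ?n. b i \<in> H) \<and> (\<forall>h\<in>H. \<exists>c. h = (\<lambda>j. \<Sum>i<?n. c i * b i j)) \<and>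
             (\<forall>c. (\<forall>j. (\<Sum>i<?n. c i * b i j) = 0) \<longrightarrow> (\<forall>i<?n. c i = 0))"
      by (rule int_lattice_basis[of M H r]) (fact assms)+
    then show ?thesis using that by (elim exE conjE) blast
  qed
  define \<psi> where "\<psi> = (\<lambda>c::nat\<Rightarrow>int. \<lambda>j. \<Sum>i<?n. c i * b i j)"
  have "\<psi> \<in> iso (Zpow ?n) (additive_group H)"
    unfolding iso_iff
  proof (intro conjI)
    show "\<psi> \<in> hom (Zpow ?n) (additive_group H)"
      using int_lattice_sum[OF assms(2), of "{..<?n}" b] b(1)
      by (auto simp: hom_def Zpow_def additive_group_def \<psi>_def sum.distrib algebra_simps)
    show "\<psi> ` carrier (Zpow ?n) = carrier (additive_group H)"
    proof
      show "\<psi> ` carrier (Zpow ?n) \<subseteq> carrier (additive_group H)"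
        using int_lattice_sum[OF assms(2), of "{..<?n}" b] b(1)
        by (auto simp: additive_group_def \<psi>_def)
      show "carrier (additive_group H) \<subseteq> \<psi> ` carrier (Zpow ?n)"
      proof
        fix h assume "h \<in> carrier (additive_group H)"
        then obtain c where "h = \<psi> c"
          using b(2) by (auto simp: \<psi>_def additive_group_def)
        \<comment> \<open>Elements of \<open>Zpow\<close> are extensional functions, hence the
          restriction.\<close>
        then have "h = \<psi> (restrict c {..<?n})"
          by (auto simp: \<psi>_def)
        then show "h \<in> \<psi> ` carrier (Zpow ?n)"
          by (auto simp: Zpow_def intro!: imageI)
      qed
    qed
    show "inj_on \<psi> (carrier (Zpow ?n))"
    proof (rule inj_onI)
      fix c c' assume cc: "c \<in> carrier (Zpow ?n)" "c' \<in> carrier (Zpow ?n)" "\<psi> c = \<psi> c'"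
      have "\<forall>j. (\<Sum>i<?n. (c i - c' i) * b i j) = 0"
        using fun_cong[OF cc(3)] by (simp add: \<psi>_def left_diff_distrib sum_subtractf)
      then have "\<forall>i<?n. c i - c' i = 0" by (rule b(3))
      then show "c = c'"
        using cc(1,2) by (intro PiE_ext[of c _ "\<lambda>_. UNIV"]) (auto simp: Zpow_def)
    qed
  qed
  moreover have "group (Zpow ?n)" by (simp add: Zpow_def)
  ultimately show ?thesis
    using group.iso_sym[of "Zpow ?n" "additive_group H"] is_isoI by blast
qed

text \<open>The image of the generator is killed by \<open>r\<close>, while \<open>Zpow n\<close> is
  torsion-free. The computation takes place in \<open>Zpow n\<close>, reached through the
  isomorphism, so triviality is expressed by comparison with \<open>s 0\<close> instead of a unit of
  \<open>G\<close>.\<close>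

lemma hom_integer_mod_group_trivial:
  assumes "G \<cong> Zpow n" "r > 1" "s \<in> hom (integer_mod_group r) G"
  shows "s 1 = s 0"
proof -
  obtain f where f: "f \<in> hom G (Zpow n)" "inj_on f (carrier G)"
    using assms(1) by (auto simp: is_iso_def iso_iff)
  have grp: "group (Zpow n)" by (simp add: Zpow_def)
  define h where "h = f \<circ> s"
  have hom: "h \<in> hom (integer_mod_group r) (Zpow n)"
    unfolding h_def using assms(3) f(1) by (rule hom_compose)
  have gh: "group_hom (integer_mod_group r) (Zpow n) h"
    using grp hom by (simp add: group_hom_def group_hom_axioms_def)
  have c1: "1 \<in> carrier (integer_mod_group r)" using assms(2) by simp
  have pow: "(x [^]\<^bsub>Zpow n\<^esub> k) i = int k * x i" if "i < n" for x :: "nat \<Rightarrow> int" and k :: nat and i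
    by (induction k) (use that in \<open>auto simp: Zpow_def algebra_simps\<close>)
  have h0: "h 0 = \<one>\<^bsub>Zpow n\<^esub>"
    using group_hom.hom_one[OF gh] by simp
  have "h (1 [^]\<^bsub>integer_mod_group r\<^esub> r) = h 1 [^]\<^bsub>Zpow n\<^esub> r"
    using group_hom.hom_nat_pow[OF gh c1] .
  then have eq: "h 1 [^]\<^bsub>Zpow n\<^esub> r = \<one>\<^bsub>Zpow n\<^esub>"
    using h0 by simp
  have "h 1 i = 0" if "i < n" for i
    using fun_cong[OF eq, of i] pow[OF that, of "h 1" r] that assms(2) by (simp add: Zpow_def)
  moreover have "h 1 \<in> carrier (Zpow n)"
    using hom c1 by (auto simp: hom_def)
  ultimately have "h 1 = \<one>\<^bsub>Zpow n\<^esub>"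
    by (intro PiE_ext[of _ "{..<n}" "\<lambda>_. UNIV"]) (auto simp: Zpow_def)
  then have "f (s 1) = f (s 0)" using h0 by (simp add: h_def)
  moreover have "s 1 \<in> carrier G" "s 0 \<in> carrier G"
    using assms(3) c1 by (auto simp: hom_def)
  ultimately show ?thesis using f(2) by (auto dest: inj_onD)
qed

section \<open>Fundamental groups via lifts to a vector space\<close>

lemma loop_class_refl: "g \<in> loops_at X x \<Longrightarrow> g \<in> loop_class X x g"
  by (auto simp: loop_class_def loops_at_def pathin_def)

lemma loop_class_eqI:
  assumes "homotopic_with (\<lambda>k. k 0 = x \<and> k 1 = x) (top_of_set {0..1}) X g h"
  shows "loop_class X x g = loop_class X x h"
proof -
  let ?hom = "homotopic_with (\<lambda>k. k 0 = x \<and> k 1 = x) (top_of_set {0..1}) X"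
  have "?hom g k \<longleftrightarrow> ?hom h k" for k
    using homotopic_with_trans[OF assms, of k] homotopic_with_trans[OF homotopic_with_symD[OF assms], of k]
    by blast
  then show ?thesis by (simp add: loop_class_def)
qed

text \<open>Controls the representatives that the multiplication of \<open>fundamental_group\<close>
  picks with \<open>SOME\<close>.\<close>

lemma loop_class_someD:
  assumes "g \<in> loops_at X x"
  defines "h \<equiv> SOME h. h \<in> loop_class X x g"
  shows "h \<in> loops_at X x"
    "homotopic_with (\<lambda>k. k 0 = x \<and> k 1 = x) (top_of_set {0..1}) X g h"
proof -
  have "h \<in> loop_class X x g"
    unfolding h_def by (rule someI[where P = "\<lambda>h. h \<in> loop_class X x g", OF loop_class_refl[OF assms(1)]])
  then show "h \<in> loops_at X x"
    "homotopic_with (\<lambda>k. k 0 = x \<and> k 1 = x) (top_of_set {0..1}) X g h"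
    by (auto simp: loop_class_def)
qed

lemma path_join_in_loops_at:
  assumes "g \<in> loops_at X x" "h \<in> loops_at X x"
  shows "path_join g h \<in> loops_at X x"
proof -
  let ?I = "top_of_set {0..1::real}"
  have g: "continuous_map ?I X g" and h: "continuous_map ?I X h"
    using assms by (auto simp: loops_at_def pathin_def)
  have "continuous_map ?I X (\<lambda>t. if t \<le> 1/2 then g (2 * t) else h (2 * t - 1))"
  proof (rule continuous_map_cases_le)
    show "continuous_map ?I euclideanreal (\<lambda>x. x)" "continuous_map ?I euclideanreal (\<lambda>x. 1/2)"
      by (auto intro: continuous_intros)
    show "continuous_map (subtopology ?I {x \<in> topspace ?I. x \<le> 1/2}) X (\<lambda>t. g (2 * t))"
      by (rule continuous_map_compose[of _ ?I _ X g, unfolded o_def, OF _ g])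
        (auto simp: subtopology_subtopology continuous_map_in_subtopology intro!: continuous_intros)
    show "continuous_map (subtopology ?I {x \<in> topspace ?I. 1/2 \<le> x}) X (\<lambda>t. h (2 * t - 1))"
      by (rule continuous_map_compose[of _ ?I _ X h, unfolded o_def, OF _ h])
        (auto simp: subtopology_subtopology continuous_map_in_subtopology intro!: continuous_intros)
  next
    fix t :: real assume "t = 1/2"
    then have "2 * t = 1" by simp
    then show "g (2 * t) = h (2 * t - 1)"
      using assms by (simp add: loops_at_def)
  qed
  then show ?thesis
    using assms by (auto simp: loops_at_def pathin_def path_join_def)
qed

text \<open>Distinct values are at least \<open>norm w\<close> apart and the interval is connected.
  This makes increments of lifts independent of the chosen lift and of a homotopy parameter.\<close>

lemma constant_on_of_discrete_values:
  fixes f :: "real \<Rightarrow> complex"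
  assumes "continuous_on {0..1} f" "w \<noteq> 0" "\<And>t. t \<in> {0..1} \<Longrightarrow> \<exists>k::int. f t = w * of_int k"
    and "t \<in> {0..1}"
  shows "f t = f 0"
proof -
  have "f constant_on {0..1}"
  proof (rule continuous_discrete_range_constant)
    fix x :: real assume x: "x \<in> {0..1}"
    show "\<exists>e>0. \<forall>y. y \<in> {0..1} \<and> f y \<noteq> f x \<longrightarrow> e \<le> norm (f y - f x)"
    proof (intro exI[of _ "norm w"] conjI allI impI)
      fix y assume y: "y \<in> {0..1} \<and> f y \<noteq> f x"
      obtain k l :: int where kl: "f x = w * of_int k" "f y = w * of_int l"
        using assms(3) x y by blast
      then have "f y - f x = w * of_int (l - k)" by (simp add: algebra_simps)
      then have "norm (f y - f x) = norm w * \<bar>of_int (l - k)\<bar>"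
        by (simp only: norm_mult norm_of_int)
      moreover have "l \<noteq> k" using y kl by auto
      then have "\<bar>real_of_int (l - k)\<bar> \<ge> 1"
        by linarith
      ultimately show "norm w \<le> norm (f y - f x)"
        using mult_left_mono[of 1 "\<bar>real_of_int (l - k)\<bar>" "norm w"] by simp
    qed (use assms in auto)
  qed (use assms in auto)
  then show ?thesis
    using assms(4) unfolding constant_on_def by force
qed

text \<open>The total space of the cover; as a linear subspace it contains the segments used for
  homotopies.\<close>

definition vanishing_on :: "nat set \<Rightarrow> (nat \<Rightarrow> complex) set" where
  "vanishing_on Z = {u. \<forall>j\<in>Z. u j = 0}"

text \<open>Over a fibre of \<open>p\<close> the coordinates in \<open>M\<close> differ by \<open>w\<close> times integer vectors; \<open>H\<close> plays the role of
  the deck transformation group.\<close>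
locale vector_space_cover =
  fixes X :: "'x topology" and p :: "(nat \<Rightarrow> complex) \<Rightarrow> 'x"
    and Z M :: "nat set" and w :: complex and H :: "(nat \<Rightarrow> int) set"
  assumes cont: "continuous_map (top_of_set (vanishing_on Z)) X p"
    and lift: "\<And>f u. continuous_map (top_of_set ({0..1} \<times> {0..1})) X f \<Longrightarrow> u \<in> vanishing_on Z \<Longrightarrow>
        p u = f (0, 0) \<Longrightarrow>
        \<exists>F. continuous_on ({0..1::real} \<times> {0..1::real}) F \<and>
            (\<forall>z\<in>{0..1} \<times> {0..1}. F z \<in> vanishing_on Z \<and> p (F z) = f z) \<and> F (0, 0) = u"
    and w: "w \<noteq> 0"
    and H_supp: "\<And>h j. h \<in> H \<Longrightarrow> j \<notin> M \<Longrightarrow> h j = 0"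
    and H_add: "\<And>h k. h \<in> H \<Longrightarrow> k \<in> H \<Longrightarrow> (\<lambda>j. h j + k j) \<in> H"
    and fibre: "\<And>u v. u \<in> vanishing_on Z \<Longrightarrow> v \<in> vanishing_on Z \<Longrightarrow> p u = p v \<Longrightarrow>
        \<exists>h\<in>H. \<forall>j\<in>M. v j - u j = w * of_int (h j)"
    and fibre_inj: "\<And>u v. u \<in> vanishing_on Z \<Longrightarrow> v \<in> vanishing_on Z \<Longrightarrow> p u = p v \<Longrightarrow>
        (\<And>j. j \<in> M \<Longrightarrow> u j = v j) \<Longrightarrow> u = v"
    and fibre_surj: "\<And>u h. u \<in> vanishing_on Z \<Longrightarrow> h \<in> H \<Longrightarrow>
        \<exists>v \<in> vanishing_on Z. p v = p u \<and> (\<forall>j\<in>M. v j - u j = w * of_int (h j))"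
begin

abbreviation "E \<equiv> vanishing_on Z"

definition is_lift :: "(real \<Rightarrow> 'x) \<Rightarrow> (real \<Rightarrow> nat \<Rightarrow> complex) \<Rightarrow> bool" where
  "is_lift g F \<longleftrightarrow> continuous_on {0..1} F \<and> (\<forall>t\<in>{0..1}. F t \<in> E \<and> p (F t) = g t)"

text \<open>At each time both lifts lie in one fibre, so their difference in a coordinate from
  \<open>M\<close> is confined to \<open>w\<close> times the integers and cannot vary.\<close>

lemma lift_unique:
  assumes "is_lift g F" "is_lift g F'" "j \<in> M"
  shows "F' 1 j - F' 0 j = F 1 j - F 0 j"
proof -
  have "(\<lambda>t. F' t j - F t j) 1 = (\<lambda>t. F' t j - F t j) 0"
  proof (rule constant_on_of_discrete_values[OF _ w])
    show "continuous_on {0..1} (\<lambda>t. F' t j - F t j)"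
      using assms unfolding is_lift_def
      by (intro continuous_on_diff; blast intro: continuous_on_product_then_coordinatewise)
    show "\<exists>k::int. F' t j - F t j = w * of_int k" if "t \<in> {0..1}" for t
    proof -
      have "F t \<in> E" "F' t \<in> E" "p (F t) = p (F' t)"
        using assms(1,2) that by (auto simp: is_lift_def)
      then show ?thesis using fibre[of "F t" "F' t"] assms(3) by blast
    qed
  qed auto
  then show ?thesis by (simp add: algebra_simps)
qed

text \<open>A path is a map of the square that is constant in the first variable.\<close>

lemma path_lift:
  assumes "pathin X g" "u \<in> E" "p u = g 0"
  obtains F where "is_lift g F" "F 0 = u"
proof -
  have "continuous_map (top_of_set ({0..1::real} \<times> {0..1})) X (g \<circ> snd)"
    using assms(1) unfolding pathin_def
    by (rule continuous_map_compose[rotated]) (auto intro!: continuous_intros)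
  then obtain F where F: "continuous_on ({0..1::real} \<times> {0..1::real}) F"
     "\<forall>z\<in>{0..1} \<times> {0..1}. F z \<in> E \<and> p (F z) = (g \<circ> snd) z" "F (0, 0) = u"
    using lift[of "g \<circ> snd" u] assms by auto
  have "continuous_on {0..1} (\<lambda>t. F (0, t))"
    by (rule continuous_on_compose2[OF F(1)]) (auto intro!: continuous_intros)
  then have "is_lift g (\<lambda>t. F (0, t))"
    unfolding is_lift_def using F(2) by auto
  with that F(3) show thesis by blast
qed

text \<open>The value does not depend on the starting point of the lift, so no deck transformations are
  needed to see that it is additive under concatenation.\<close>
definition winding :: "(real \<Rightarrow> 'x) \<Rightarrow> nat \<Rightarrow> int" where
  "winding g = (THE h. h \<in> H \<and> (\<exists>F. is_lift g F \<and> (\<forall>j\<in>M. F 1 j - F 0 j = w * of_int (h j))))"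

text \<open>Any lift computes the described vector: on \<open>M\<close> by
  \<open>lift_unique\<close> and \<open>w \<noteq> 0\<close>, off \<open>M\<close> because members
  of \<open>H\<close> vanish there.\<close>

lemma winding_eqI:
  assumes "is_lift g F" "h \<in> H" "\<And>j. j \<in> M \<Longrightarrow> F 1 j - F 0 j = w * of_int (h j)"
  shows "winding g = h"
  unfolding winding_def
proof (rule the_equality)
  fix h' assume h': "h' \<in> H \<and> (\<exists>F. is_lift g F \<and> (\<forall>j\<in>M. F 1 j - F 0 j = w * of_int (h' j)))"
  then obtain F' where F': "is_lift g F'" "\<forall>j\<in>M. F' 1 j - F' 0 j = w * of_int (h' j)" by blast
  show "h' = h"
  proof
    fix j
    show "h' j = h j"
    proof (cases "j \<in> M")
      case True
      then have "w * of_int (h' j) = w * of_int (h j)"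
        using lift_unique[OF assms(1) F'(1) True] F'(2) assms(3) by metis
      then show ?thesis using w by simp
    next
      case False
      then show ?thesis using H_supp[of h' j] H_supp[of h j] h' assms(2) by simp
    qed
  qed
qed (use assms in auto)

lemma winding_lift:
  assumes "is_lift g F" "g 0 = g 1"
  shows "winding g \<in> H" "\<And>j. j \<in> M \<Longrightarrow> F 1 j - F 0 j = w * of_int (winding g j)"
proof -
  obtain h where h: "h \<in> H" "\<forall>j\<in>M. F 1 j - F 0 j = w * of_int (h j)"
    using fibre[of "F 0" "F 1"] assms by (auto simp: is_lift_def)
  then have "winding g = h"
    using winding_eqI[OF assms(1)] by blast
  with h show "winding g \<in> H" "\<And>j. j \<in> M \<Longrightarrow> F 1 j - F 0 j = w * of_int (winding g j)"
    by auto
qed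

text \<open>Both ends of every slice of the lifted square lie over the base point, so the increment
  along a slice is a continuous function of the homotopy parameter with discrete values.\<close>

lemma winding_homotopic:
  assumes u: "u \<in> E"
    and hom: "homotopic_with (\<lambda>k. k 0 = p u \<and> k 1 = p u) (top_of_set {0..1}) X g h"
  shows "winding g = winding h"
proof -
  obtain k where k: "continuous_map (prod_topology (top_of_set {0..1::real}) (top_of_set {0..1::real})) X k"
    "\<And>t. k (0, t) = g t" "\<And>t. k (1, t) = h t"
    "\<And>s. s \<in> {0..1} \<Longrightarrow> k (s, 0) = p u \<and> k (s, 1) = p u"
    using hom unfolding homotopic_with_def by auto
  have "continuous_map (top_of_set ({0..1::real} \<times> {0..1::real})) X k"
    using k(1) by simp
  then obtain F where F: "continuous_on ({0..1::real} \<times> {0..1::real}) F"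
     "\<And>z. z\<in>{0..1} \<times> {0..1} \<Longrightarrow> F z \<in> E \<and> p (F z) = k z"
    using lift[of k u] u k(4)[of 0] by auto
  have slice: "is_lift (\<lambda>t. k (s, t)) (\<lambda>t. F (s, t))" if "s \<in> {0..1}" for s
  proof -
    have "continuous_on {0..1} (\<lambda>t. F (s, t))"
      by (rule continuous_on_compose2[OF F(1)]) (use that in \<open>auto intro!: continuous_intros\<close>)
    then show ?thesis unfolding is_lift_def using F(2) that by auto
  qed
  have l0: "is_lift g (\<lambda>t. F (0, t))" and l1: "is_lift h (\<lambda>t. F (1, t))"
    using slice[of 0] slice[of 1] k(2,3) by auto
  have ends: "g 0 = g 1" "h 0 = h 1"
    using k(2,3) k(4)[of 0] k(4)[of 1] by auto
  have const: "F (1, 1) j - F (1, 0) j = F (0, 1) j - F (0, 0) j" if j: "j \<in> M" for j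
  proof (rule constant_on_of_discrete_values[OF _ w])
    show "continuous_on {0..1} (\<lambda>s. F (s, 1) j - F (s, 0) j)"
    proof (intro continuous_on_diff)
      have "continuous_on {0..1} (\<lambda>s. F (s, t))" if "t \<in> {0..1}" for t
        by (rule continuous_on_compose2[OF F(1)]) (use that in \<open>auto intro!: continuous_intros\<close>)
      then show "continuous_on {0..1} (\<lambda>s. F (s, 1) j)" "continuous_on {0..1} (\<lambda>s. F (s, 0) j)"
        by (auto intro: continuous_on_product_then_coordinatewise)
    qed
    show "\<exists>n::int. F (s, 1) j - F (s, 0) j = w * of_int n" if "s \<in> {0..1}" for s
      using fibre[of "F (s, 0)" "F (s, 1)"] F(2)[of "(s, 0)"] F(2)[of "(s, 1)"] k(4)[OF that] that j
      by auto
  qed auto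
  show ?thesis
  proof (rule winding_eqI[OF l0 winding_lift(1)[OF l1 ends(2)]])
    fix j assume "j \<in> M"
    then show "F (0, 1) j - F (0, 0) j = w * of_int (winding h j)"
      using const winding_lift(2)[OF l1 ends(2)] by simp
  qed
qed

text \<open>Lifts from the same starting point with equal windings also end in the same point, by
  \<open>fibre_inj\<close>; the straight-line homotopy between them then keeps both ends fixed and
  can be projected.\<close>

lemma homotopic_winding:
  assumes u: "u \<in> E" and g: "g \<in> loops_at X (p u)" and h: "h \<in> loops_at X (p u)"
    and "winding g = winding h"
  shows "homotopic_with (\<lambda>k. k 0 = p u \<and> k 1 = p u) (top_of_set {0..1}) X g h"
proof -
  obtain F where F: "is_lift g F" "F 0 = u"
    using path_lift[of g u] g u by (auto simp: loops_at_def)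
  obtain G where G: "is_lift h G" "G 0 = u"
    using path_lift[of h u] h u by (auto simp: loops_at_def)
  have FE: "F t \<in> E" "G t \<in> E" "p (F t) = g t" "p (G t) = h t" if "t \<in> {0..1}" for t
    using F G that by (auto simp: is_lift_def)
  have contFG: "continuous_on {0..1} (\<lambda>t. F t j)" "continuous_on {0..1} (\<lambda>t. G t j)" for j
    using F G by (auto simp: is_lift_def intro: continuous_on_product_then_coordinatewise)
  have FG1: "F 1 = G 1"
  proof (rule fibre_inj)
    fix j assume j: "j \<in> M"
    have "F 1 j - F 0 j = G 1 j - G 0 j"
      using winding_lift(2)[OF F(1) _ j] winding_lift(2)[OF G(1) _ j] g h assms(4)
      by (auto simp: loops_at_def)
    then show "F 1 j = G 1 j" using F(2) G(2) by simp
  qed (use FE[of 1] g h in \<open>auto simp: loops_at_def\<close>)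
  define K where "K = (\<lambda>(s::real, t). \<lambda>j. (1 - of_real s) * F t j + of_real s * G t j)"
  have contK: "continuous_on ({0..1} \<times> {0..1}) K"
    unfolding K_def case_prod_unfold
    by (intro continuous_on_coordinatewise_then_product continuous_intros
          continuous_on_compose2[OF contFG(1)] continuous_on_compose2[OF contFG(2)]) auto
  have KE: "K z \<in> E" if "z \<in> {0..1} \<times> {0..1}" for z
    using FE(1,2)[of "snd z"] that by (auto simp: K_def vanishing_on_def case_prod_unfold)
  have "continuous_map (prod_topology (top_of_set {0..1::real}) (top_of_set {0..1::real})) X (p \<circ> K)"
    by (rule continuous_map_compose[OF _ cont]) (use contK KE in auto)
  then have "homotopic_with (\<lambda>k. k 0 = p u \<and> k 1 = p u) (top_of_set {0..1}) X
      (\<lambda>t. (p \<circ> K) (0, t)) (\<lambda>t. (p \<circ> K) (1, t))"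
  proof (subst homotopic_with, goal_cases)
    case 2
    have "p (K (s, 0)) = p u" "p (K (s, 1)) = p u" if "s \<in> {0..1}" for s
    proof -
      have "K (s, 0) = u" by (auto simp: K_def F(2) G(2) algebra_simps)
      then show "p (K (s, 0)) = p u" by simp
      have "K (s, 1) = F 1" by (auto simp: K_def FG1 algebra_simps)
      then show "p (K (s, 1)) = p u" using FE(3)[of 1] g by (simp add: loops_at_def)
    qed
    with 2 show ?case by (intro exI[of _ "p \<circ> K"]) auto
  qed auto
  moreover have "(p \<circ> K) (0, t) = g t" "(p \<circ> K) (1, t) = h t" if "t \<in> {0..1}" for t
    using FE(3,4)[OF that] by (auto simp: K_def)
  ultimately show ?thesis
    by (elim homotopic_with_eq) auto
qed

text \<open>The two halves of a single lift of the join, reparametrised, are lifts of the factors,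
  and increments add up along it.\<close>

lemma winding_path_join:
  assumes u: "u \<in> E" and g: "g \<in> loops_at X (p u)" and h: "h \<in> loops_at X (p u)"
  shows "winding (path_join g h) = (\<lambda>j. winding g j + winding h j)"
proof -
  obtain F where F: "is_lift (path_join g h) F" "F 0 = u"
    using path_lift[of "path_join g h" u] path_join_in_loops_at[OF g h] u by (auto simp: loops_at_def)
  have cF: "continuous_on {0..1} F" using F(1) by (simp add: is_lift_def)
  have F1: "is_lift g (\<lambda>t. F (t / 2))"
    unfolding is_lift_def
  proof (intro conjI ballI)
    show "continuous_on {0..1} (\<lambda>t. F (t / 2))"
      by (rule continuous_on_compose2[OF cF]) (auto intro!: continuous_intros)
    fix t :: real assume t: "t \<in> {0..1}"
    then show "F (t / 2) \<in> E" using F(1) by (auto simp: is_lift_def)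
    have "p (F (t / 2)) = path_join g h (t / 2)" using F(1) t by (auto simp: is_lift_def)
    then show "p (F (t / 2)) = g t" using t by (simp add: path_join_def)
  qed
  have F2: "is_lift h (\<lambda>t. F (1 / 2 + t / 2))"
    unfolding is_lift_def
  proof (intro conjI ballI)
    show "continuous_on {0..1} (\<lambda>t. F (1 / 2 + t / 2))"
      by (rule continuous_on_compose2[OF cF]) (auto intro!: continuous_intros)
    fix t :: real assume t: "t \<in> {0..1}"
    then show "F (1 / 2 + t / 2) \<in> E" using F(1) by (auto simp: is_lift_def)
    have "p (F (1 / 2 + t / 2)) = path_join g h (1 / 2 + t / 2)"
      using F(1) t by (auto simp: is_lift_def)
    \<comment> \<open>At \<open>t = 0\<close> the join is evaluated at 1/2, where its first branch
      applies and gives \<open>g 1\<close>; this equals \<open>h 0\<close>.\<close>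
    also have "\<dots> = h t"
      using t g h by (cases "t = 0") (auto simp: path_join_def loops_at_def add_divide_distrib)
    finally show "p (F (1 / 2 + t / 2)) = h t" .
  qed
  have ends: "g 0 = g 1" "h 0 = h 1" using g h by (auto simp: loops_at_def)
  show ?thesis
  proof (rule winding_eqI[OF F(1)])
    show "(\<lambda>j. winding g j + winding h j) \<in> H"
      using winding_lift(1)[OF F1 ends(1)] winding_lift(1)[OF F2 ends(2)] by (rule H_add)
    fix j assume "j \<in> M"
    then show "F 1 j - F 0 j = w * of_int (winding g j + winding h j)"
      using winding_lift(2)[OF F1 ends(1), of j] winding_lift(2)[OF F2 ends(2), of j]
      by (simp add: algebra_simps)
  qed
qed

lemma winding_in_H:
  assumes "u \<in> E" "g \<in> loops_at X (p u)"
  shows "winding g \<in> H"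
proof -
  have g: "pathin X g" "g 0 = p u" "g 0 = g 1"
    using assms(2) by (auto simp: loops_at_def)
  obtain F where "is_lift g F"
    using path_lift[OF g(1) assms(1)] g(2) by metis
  then show ?thesis using g(3) by (rule winding_lift(1))
qed

text \<open>A straight segment between two points of one fibre projects to a loop.\<close>

lemma winding_surj:
  assumes u: "u \<in> E" and h: "h \<in> H"
  obtains g where "g \<in> loops_at X (p u)" "winding g = h"
proof -
  obtain v where v: "v \<in> E" "p v = p u" "\<And>j. j \<in> M \<Longrightarrow> v j - u j = w * of_int (h j)"
    using fibre_surj[OF u h] by auto
  define F where "F = (\<lambda>t::real. \<lambda>j. (1 - of_real t) * u j + of_real t * v j)"
  have cF: "continuous_on {0..1} F"
    unfolding F_def by (intro continuous_on_coordinatewise_then_product continuous_intros)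
  have FE: "F t \<in> E" for t
    using u v(1) by (auto simp: F_def vanishing_on_def)
  have F01: "F 0 = u" "F 1 = v" by (auto simp: F_def)
  have "continuous_map (top_of_set {0..1}) X (p \<circ> F)"
    by (rule continuous_map_compose[OF _ cont]) (use cF FE in auto)
  then have "p \<circ> F \<in> loops_at X (p u)"
    using F01 v(2) by (auto simp: loops_at_def pathin_def)
  moreover have "is_lift (p \<circ> F) F"
    using cF FE by (auto simp: is_lift_def)
  then have "winding (p \<circ> F) = h"
    using F01 v(3) h by (intro winding_eqI) auto
  ultimately show thesis by (rule that)
qed

theorem fundamental_group_iso:
  assumes u: "u \<in> E"
  shows "fundamental_group X (p u) \<cong> additive_group H"
proof -
  let ?x = "p u"
  \<comment> \<open>The same choice as in the multiplication of \<open>fundamental_group\<close>, so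
    that a product unfolds to the join of representatives.\<close>
  define rep :: "(real \<Rightarrow> 'x) set \<Rightarrow> real \<Rightarrow> 'x" where "rep A = (SOME g. g \<in> A)" for A
  have rep1: "rep (loop_class X ?x g) \<in> loops_at X ?x" if "g \<in> loops_at X ?x" for g
    using loop_class_someD(1)[OF that] by (simp only: rep_def)
  have rep2: "winding (rep (loop_class X ?x g)) = winding g" if "g \<in> loops_at X ?x" for g
    using winding_homotopic[OF u loop_class_someD(2)[OF that]] by (simp only: rep_def)
  have "(\<lambda>A. winding (rep A)) \<in> iso (fundamental_group X ?x) (additive_group H)"
    unfolding iso_iff
  proof (intro conjI)
    show "(\<lambda>A. winding (rep A)) \<in> hom (fundamental_group X ?x) (additive_group H)"
    proof (rule homI)
      fix A assume "A \<in> carrier (fundamental_group X ?x)"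
      then show "winding (rep A) \<in> carrier (additive_group H)"
        using rep1 winding_in_H[OF u] by (auto simp: fundamental_group_def additive_group_def)
    next
      fix A B assume "A \<in> carrier (fundamental_group X ?x)" "B \<in> carrier (fundamental_group X ?x)"
      then have AB: "rep A \<in> loops_at X ?x" "rep B \<in> loops_at X ?x"
        using rep1 by (auto simp: fundamental_group_def)
      have "A \<otimes>\<^bsub>fundamental_group X ?x\<^esub> B = loop_class X ?x (path_join (rep A) (rep B))"
        by (simp add: fundamental_group_def rep_def)
      then show "winding (rep (A \<otimes>\<^bsub>fundamental_group X ?x\<^esub> B)) =
          winding (rep A) \<otimes>\<^bsub>additive_group H\<^esub> winding (rep B)"
        using rep2[OF path_join_in_loops_at[OF AB]] winding_path_join[OF u AB]
        by (simp add: additive_group_def)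
    qed
    show "(\<lambda>A. winding (rep A)) ` carrier (fundamental_group X ?x) = carrier (additive_group H)"
    proof
      show "(\<lambda>A. winding (rep A)) ` carrier (fundamental_group X ?x) \<subseteq> carrier (additive_group H)"
        using rep1 winding_in_H[OF u] by (auto simp: fundamental_group_def additive_group_def)
      show "carrier (additive_group H) \<subseteq> (\<lambda>A. winding (rep A)) ` carrier (fundamental_group X ?x)"
      proof
        fix h assume "h \<in> carrier (additive_group H)"
        then obtain g where g: "g \<in> loops_at X ?x" "winding g = h"
          using winding_surj[OF u] by (auto simp: additive_group_def)
        then show "h \<in> (\<lambda>A. winding (rep A)) ` carrier (fundamental_group X ?x)"
          using rep2[OF g(1)] by (intro image_eqI[of _ _ "loop_class X ?x g"]) (auto simp: fundamental_group_def)
      qed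
    qed
    show "inj_on (\<lambda>A. winding (rep A)) (carrier (fundamental_group X ?x))"
    proof (rule inj_onI)
      fix A B assume "A \<in> carrier (fundamental_group X ?x)" "B \<in> carrier (fundamental_group X ?x)"
        and eq: "winding (rep A) = winding (rep B)"
      then obtain g h where gh: "g \<in> loops_at X ?x" "h \<in> loops_at X ?x"
        "A = loop_class X ?x g" "B = loop_class X ?x h"
        by (auto simp: fundamental_group_def)
      have "winding g = winding h" using eq rep2 gh by simp
      then show "A = B"
        using loop_class_eqI[OF homotopic_winding[OF u gh(1,2)]] gh by simp
    qed
  qed
  then show ?thesis by (rule is_isoI)
qed

end

section \<open>Cyclic quotients of tori\<close>

text \<open>The two-term Bezout identity for the new element and the previous gcd rescales all
  earlier coefficients by \<open>b\<close>.\<close>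

lemma bezout_Gcd:
  assumes "finite M"
  shows "\<exists>e t. (\<Sum>j\<in>M. e j * int j) + t * int r = int (Gcd (insert r M))"
  using assms
proof (induction rule: finite_induct)
  case empty
  show ?case by (intro exI[of _ "\<lambda>_. 0"] exI[of _ 1]) simp
next
  case (insert k M)
  then obtain e t where et: "(\<Sum>j\<in>M. e j * int j) + t * int r = int (Gcd (insert r M))"
    by blast
  obtain a b where ab: "a * int k + b * int (Gcd (insert r M)) = gcd (int k) (int (Gcd (insert r M)))"
    using bezout_int by blast
  have "Gcd (insert r (insert k M)) = gcd k (Gcd (insert r M))"
    by (simp add: gcd.left_commute)
  then have g: "int (Gcd (insert r (insert k M))) = a * int k + b * int (Gcd (insert r M))"
    using ab by (metis gcd_int_int_eq)
  have "(\<Sum>j\<in>insert k M. (if j = k then a else b * e j) * int j) + (b * t) * int r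
      = a * int k + (\<Sum>j\<in>M. b * e j * int j) + b * t * int r"
    using insert.hyps by (auto intro!: sum.cong)
  also have "\<dots> = a * int k + b * ((\<Sum>j\<in>M. e j * int j) + t * int r)"
    by (simp add: algebra_simps sum_distrib_left)
  also have "\<dots> = int (Gcd (insert r (insert k M)))"
    unfolding et g ..
  finally show ?case by (intro exI[of _ "\<lambda>j. if j = k then a else b * e j"] exI[of _ "b * t"])
qed

text \<open>With \<open>g\<close> the gcd of \<open>r\<close> and \<open>M\<close>, the quotient
  \<open>r / g\<close> passes the test in \<open>faithful\<close>, so \<open>r\<close> divides it
  and \<open>g = 1\<close>. Bezout coefficients are reduced modulo \<open>r\<close> to make them
  natural numbers, ready to serve as exponents of a monomial.\<close>

lemma unit_combination_mod:
  assumes "finite M" "r > 0" and faithful: "\<And>m::int. (\<And>j. j \<in> M \<Longrightarrow> int r dvd m * int j) \<Longrightarrow> int r dvd m"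
  obtains e :: "nat \<Rightarrow> nat" where "int r dvd (\<Sum>j\<in>M. int (e j) * int j) - 1"
proof -
  define g where "g = Gcd (insert r M)"
  have g_dvd: "g dvd j" if "j \<in> insert r M" for j
    unfolding g_def using that by (rule Gcd_dvd)
  obtain m where m: "r = g * m" using g_dvd[of r] by blast
  have "int r dvd int m"
  proof (rule faithful)
    fix j assume "j \<in> M"
    then obtain i where "j = g * i" using g_dvd[of j] by blast
    then show "int r dvd int m * int j" using m by simp
  qed
  then have "r dvd m" by simp
  moreover have "m > 0" using m assms(2) by (cases m) auto
  ultimately have "r \<le> m" by (rule dvd_imp_le)
  then have "g = 1" using m \<open>m > 0\<close> assms(2) by (cases g) auto
  then obtain e t where et: "(\<Sum>j\<in>M. e j * int j) + t * int r = 1"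
    using bezout_Gcd[OF assms(1), of r] unfolding g_def by force
  have "(\<Sum>j\<in>M. int (nat (e j mod int r)) * int j) - 1 =
      (\<Sum>j\<in>M. (e j mod int r - e j) * int j) - t * int r"
    using assms(2) et by (simp add: left_diff_distrib sum_subtractf)
  also have "int r dvd \<dots>"
  proof (intro dvd_diff[OF dvd_sum dvd_triv_right] dvd_mult2)
    show "int r dvd e j mod int r - e j" for j
      by (simp add: mod_eq_dvd_iff[symmetric])
  qed
  finally show thesis using that[of "\<lambda>j. nat (e j mod int r)"] by simp
qed

section \<open>Roots of unity and weighted rotations of coordinates\<close>

definition root_of_unity :: "nat \<Rightarrow> int \<Rightarrow> complex" where
  "root_of_unity r k = exp (- (2 * of_real pi * \<i> * of_int k / of_nat r))"

lemma root_of_unity_add: "root_of_unity r (k + l) = root_of_unity r k * root_of_unity r l"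
  by (simp add: root_of_unity_def exp_add[symmetric] algebra_simps add_divide_distrib)

lemma root_of_unity_0 [simp]: "root_of_unity r 0 = 1"
  by (simp add: root_of_unity_def)

lemma root_of_unity_nonzero [simp]: "root_of_unity r k \<noteq> 0"
  by (simp add: root_of_unity_def)

lemma root_of_unity_power: "root_of_unity r k ^ n = root_of_unity r (int n * k)"
  by (induction n) (simp_all add: root_of_unity_add algebra_simps)

lemma root_of_unity_sum:
  "finite A \<Longrightarrow> root_of_unity r (\<Sum>x\<in>A. f x) = (\<Prod>x\<in>A. root_of_unity r (f x))"
  by (induction rule: finite_induct) (simp_all add: root_of_unity_add)

lemma root_of_unity_eq_1_iff:
  assumes "r > 0"
  shows "root_of_unity r k = 1 \<longleftrightarrow> int r dvd k"
proof -
  have "root_of_unity r k = 1 \<longleftrightarrow> (\<exists>n::int. - (2 * pi * real_of_int k / real r) = of_int (2 * n) * pi)"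
    unfolding root_of_unity_def exp_eq_1 by simp
  also have "\<dots> \<longleftrightarrow> (\<exists>n::int. real_of_int k = real_of_int (int r * (- n)))"
  proof (rule ex_cong1)
    fix n :: int
    have "- (2 * pi * real_of_int k / real r) = of_int (2 * n) * pi \<longleftrightarrow>
        (2 * pi) * (- (real_of_int k / real r)) = (2 * pi) * real_of_int n"
      by (simp add: algebra_simps)
    also have "\<dots> \<longleftrightarrow> - (real_of_int k / real r) = real_of_int n"
      by (subst mult_cancel_left) auto
    also have "\<dots> \<longleftrightarrow> real_of_int k = real_of_int (int r * (- n))"
      using assms by (auto simp: field_simps)
    finally show "- (2 * pi * real_of_int k / real r) = of_int (2 * n) * pi \<longleftrightarrow>
        real_of_int k = real_of_int (int r * (- n))" .
  qed
  also have "\<dots> \<longleftrightarrow> int r dvd k"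
    unfolding of_int_eq_iff dvd_def by (metis minus_minus)
  finally show ?thesis .
qed

lemma root_of_unity_cong:
  assumes "r > 0" "int r dvd k - l"
  shows "root_of_unity r k = root_of_unity r l"
  using root_of_unity_add[of r "k - l" l] root_of_unity_eq_1_iff[of r "k - l"] assms by simp

lemma root_of_unity_surj:
  assumes "r > 0" "x ^ r = 1"
  obtains k where "x = root_of_unity r k"
proof -
  have "x \<noteq> 0" using assms by (auto simp: power_0_left)
  then have x: "exp (Ln x) = x" by simp
  then have "exp (of_nat r * Ln x) = 1" using assms by (simp add: exp_of_nat_mult)
  then obtain n :: int where n: "Re (of_nat r * Ln x) = 0" "Im (of_nat r * Ln x) = of_int (2 * n) * pi"
    by (auto simp: exp_eq_1)
  have "of_nat r * Ln x = 2 * of_real pi * \<i> * of_int n"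
    using n by (intro complex_eqI) auto
  then have "Ln x = 2 * of_real pi * \<i> * of_int n / of_nat r"
    using assms(1) by (simp add: field_simps)
  then have "x = root_of_unity r (- n)"
    using x by (simp add: root_of_unity_def)
  then show thesis by (rule that)
qed

text \<open>The \<open>m\<close>-th power of \<open>sigma\<close> read on the coefficients of
  \<open>x^(j/r)\<close>. Admitting all integers \<open>m\<close> makes inverses and sums available
  without reduction modulo \<open>r\<close>.\<close>

definition rotate_coeffs :: "nat \<Rightarrow> int \<Rightarrow> (nat \<Rightarrow> complex) \<Rightarrow> nat \<Rightarrow> complex" where
  "rotate_coeffs r m a = (\<lambda>j. root_of_unity r (m * int j) * a j)"

definition torus_set :: "nat set \<Rightarrow> nat set \<Rightarrow> (nat \<Rightarrow> complex) set" where
  "torus_set Z M = {a. (\<forall>j\<in>Z. a j = 0) \<and> (\<forall>j\<in>M. a j \<noteq> 0)}"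

lemma rotate_coeffs_in_torus_set [simp]: "rotate_coeffs r m a \<in> torus_set Z M \<longleftrightarrow> a \<in> torus_set Z M"
  by (auto simp: rotate_coeffs_def torus_set_def)

lemma rotate_coeffs_add: "rotate_coeffs n (k + l) a = rotate_coeffs n k (rotate_coeffs n l a)"
  by (simp add: rotate_coeffs_def distrib_right root_of_unity_add fun_eq_iff)

lemma rotate_coeffs_0: "rotate_coeffs n 0 a = a"
  by (simp add: rotate_coeffs_def)

lemma rotate_coeffs_mod:
  assumes "r > 0"
  shows "rotate_coeffs r (m mod int r) a = rotate_coeffs r m a"
proof -
  have "root_of_unity r (m mod int r * int j) = root_of_unity r (m * int j)" for j
  proof (rule root_of_unity_cong[OF assms])
    have "int r dvd (m mod int r - m) * int j"
      by (intro dvd_mult2) (simp add: mod_eq_dvd_iff[symmetric])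
    then show "int r dvd m mod int r * int j - m * int j" by (simp add: left_diff_distrib)
  qed
  then show ?thesis by (simp add: rotate_coeffs_def)
qed

lemma continuous_on_coordinate: "continuous_on S (\<lambda>a::'a \<Rightarrow> 'b::topological_space. a j)"
  by (rule continuous_on_subset[OF continuous_on_product_coordinates subset_UNIV])

text \<open>\<open>Y\<close> enters only through a quotient map whose fibres are the rotation
  orbits, so the identity map with \<open>r = 1\<close> is an instance as well. Since coordinates in
  \<open>M\<close> never vanish, \<open>faithful\<close> yields freeness of the rotation
  action.\<close>

locale torus_quotient =
  fixes r :: nat and Z M :: "nat set" and Y :: "'y topology" and orb :: "(nat \<Rightarrow> complex) \<Rightarrow> 'y"
  assumes r: "r > 0" and M: "finite M" "M \<inter> Z = {}"
    and faithful: "\<And>m::int. (\<And>j. j \<in> M \<Longrightarrow> int r dvd m * int j) \<Longrightarrow> int r dvd m"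
    and quot: "quotient_map (top_of_set (torus_set Z M)) Y orb"
    and orb_eq: "\<And>a b. a \<in> torus_set Z M \<Longrightarrow> b \<in> torus_set Z M \<Longrightarrow>
        orb a = orb b \<longleftrightarrow> (\<exists>m. b = rotate_coeffs r m a)"
begin

abbreviation "B \<equiv> torus_set Z M"

definition exp_map :: "(nat \<Rightarrow> complex) \<Rightarrow> nat \<Rightarrow> complex" where
  "exp_map u = (\<lambda>j. if j \<in> M then exp (u j) else u j)"

text \<open>This is \<open>r\<close> times the lattice generated by the integer vectors on
  \<open>M\<close> and the vector with entries \<open>j/r\<close>; the denominator is absorbed into
  the unit \<open>2 pi i / r\<close> of increments. For \<open>r = 1\<close> it consists of all
  integer vectors supported in \<open>M\<close>.\<close>

definition deck :: "(nat \<Rightarrow> int) set" where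
  "deck = {h. (\<forall>j. j \<notin> M \<longrightarrow> h j = 0) \<and> (\<exists>m::int. \<forall>j\<in>M. int r dvd h j + m * int j)}"

lemma exp_map_in_B: "u \<in> vanishing_on Z \<Longrightarrow> exp_map u \<in> B"
  using M by (auto simp: exp_map_def vanishing_on_def torus_set_def)

lemma exp_map_surj:
  assumes "a \<in> B"
  obtains u where "u \<in> vanishing_on Z" "exp_map u = a"
proof
  let ?u = "\<lambda>j. if j \<in> M then Ln (a j) else a j"
  show "?u \<in> vanishing_on Z" using assms M by (auto simp: vanishing_on_def torus_set_def)
  show "exp_map ?u = a" using assms by (auto simp: exp_map_def torus_set_def)
qed

lemma int_lattice_deck: "int_lattice deck"
  unfolding int_lattice_def
proof (intro conjI ballI)
  show "(\<lambda>_. 0) \<in> deck" unfolding deck_def by (auto intro!: exI[of _ 0])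
  fix f g assume "f \<in> deck" "g \<in> deck"
  then obtain m n where mn: "\<forall>j. j \<notin> M \<longrightarrow> f j = 0 \<and> g j = 0"
    "\<forall>j\<in>M. int r dvd f j + m * int j" "\<forall>j\<in>M. int r dvd g j + n * int j"
    unfolding deck_def by auto
  have "int r dvd (f j - g j) + (m - n) * int j" if "j \<in> M" for j
    using dvd_diff[OF mn(2)[rule_format, OF that] mn(3)[rule_format, OF that]]
    by (simp add: algebra_simps)
  with mn(1) show "(\<lambda>j. f j - g j) \<in> deck" unfolding deck_def by auto
qed

text \<open>The choice \<open>m = 0\<close> puts \<open>r\<close> times each unit vector into the
  lattice, which forces full rank.\<close>

lemma deck_iso_Zpow: "additive_group deck \<cong> Zpow (card M)"
proof -
  have supp: "h j = 0" if "h \<in> deck" "j \<notin> M" for h j using that by (auto simp: deck_def)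
  have delta: "(\<lambda>j. if j = k then int r else 0) \<in> deck" if "k \<in> M" for k
    using that by (auto simp: deck_def intro!: exI[of _ 0])
  show ?thesis
    by (rule int_lattice_iso_Zpow[of M deck "int r"]) (use r in \<open>auto simp: M int_lattice_deck supp delta\<close>)
qed

lemma square_lift_to_B:
  assumes f: "continuous_map (top_of_set ({0..1::real} \<times> {0..1::real})) Y f" and a: "a \<in> B" "orb a = f (0, 0)"
  obtains A where "continuous_on ({0..1::real} \<times> {0..1::real}) A"
    "\<And>z. z \<in> {0..1} \<times> {0..1} \<Longrightarrow> A z \<in> B \<and> orb (A z) = f z" "A (0, 0) = a"
proof -
  let ?S = "{0..1::real} \<times> {0..1::real}"
  obtain e :: "nat \<Rightarrow> nat" where e: "int r dvd (\<Sum>j\<in>M. int (e j) * int j) - 1"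
    using unit_combination_mod[OF M(1) r] faithful by blast
  \<comment> \<open>The monomial \<open>\<theta>\<close> has weight 1 under the rotation, so \<open>\<theta>\<^sup>r\<close> and all \<open>a\<^sub>j / \<theta>\<^sup>j\<close> descend to the
    quotient; choosing an \<open>r\<close>-th root of \<open>\<theta>\<^sup>r\<close> along \<open>f\<close> recovers the point \<open>a\<close>.\<close>
  define \<theta> where "\<theta> = (\<lambda>a::nat \<Rightarrow> complex. \<Prod>j\<in>M. a j ^ e j)"
  have \<theta>_nz: "\<theta> b \<noteq> 0" if "b \<in> B" for b
    using that M(1) by (auto simp: \<theta>_def torus_set_def)
  have \<theta>_rot: "\<theta> (rotate_coeffs r m b) = root_of_unity r m * \<theta> b" for m b
  proof -
    have "\<theta> (rotate_coeffs r m b) = (\<Prod>j\<in>M. root_of_unity r (m * int j) ^ e j) * \<theta> b"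
      by (simp add: \<theta>_def rotate_coeffs_def power_mult_distrib prod.distrib)
    also have "(\<Prod>j\<in>M. root_of_unity r (m * int j) ^ e j) = root_of_unity r (m * (\<Sum>j\<in>M. int (e j) * int j))"
      by (simp add: root_of_unity_power root_of_unity_sum[OF M(1), symmetric] sum_distrib_left algebra_simps)
    also have "\<dots> = root_of_unity r m"
      using dvd_mult[OF e, of m] by (intro root_of_unity_cong r) (simp add: algebra_simps)
    finally show ?thesis .
  qed
  have \<theta>_cont: "continuous_on S \<theta>" for S
    unfolding \<theta>_def by (intro continuous_intros continuous_on_coordinate)
  \<comment> \<open>A set-theoretic section only. The functions \<open>c\<close> and
    \<open>d j\<close> built from it are rotation invariant, and they are continuous because
    \<open>orb\<close> is a quotient map and their composites with \<open>orb\<close> are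
    continuous.\<close>
  define sec where "sec y = (SOME b. b \<in> B \<and> orb b = y)" for y
  have sec: "sec y \<in> B" "orb (sec y) = y" if "y \<in> topspace Y" for y
  proof -
    have "y \<in> orb ` B"
      using that quot unfolding quotient_map_def by simp
    then have "\<exists>b. b \<in> B \<and> orb b = y" by blast
    then show "sec y \<in> B" "orb (sec y) = y"
      unfolding sec_def by (metis (mono_tags, lifting) someI_ex)+
  qed
  have orb_top: "orb b \<in> topspace Y" if "b \<in> B" for b
    using that quot unfolding quotient_map_def by auto
  have sec_orb: "\<exists>m. sec (orb b) = rotate_coeffs r m b" if "b \<in> B" for b
    using orb_eq[OF that sec(1)[OF orb_top[OF that]]] sec(2)[OF orb_top[OF that]] by simp
  define c where "c y = \<theta> (sec y) ^ r" for y
  define d where "d j y = sec y j / \<theta> (sec y) ^ j" for j y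
  have c_orb: "c (orb b) = \<theta> b ^ r" if b: "b \<in> B" for b
  proof -
    obtain m where m: "sec (orb b) = rotate_coeffs r m b" using sec_orb[OF b] by blast
    have "root_of_unity r m ^ r = 1"
      by (simp add: root_of_unity_power root_of_unity_eq_1_iff[OF r])
    then show ?thesis unfolding c_def m \<theta>_rot by (simp add: power_mult_distrib)
  qed
  have d_orb: "d j (orb b) = b j / \<theta> b ^ j" if b: "b \<in> B" for b j
  proof -
    obtain m where m: "sec (orb b) = rotate_coeffs r m b" using sec_orb[OF b] by blast
    show ?thesis
      unfolding d_def m \<theta>_rot
      by (simp add: rotate_coeffs_def power_mult_distrib root_of_unity_power mult.commute)
  qed
  have "continuous_map (top_of_set B) euclidean (c \<circ> orb)"
    by (rule continuous_map_eq[of _ _ "\<lambda>b. \<theta> b ^ r"])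
      (use c_orb in \<open>auto intro!: continuous_intros \<theta>_cont\<close>)
  then have "continuous_map (top_of_set ?S) euclidean (c \<circ> f)"
    by (intro continuous_map_compose[OF f] continuous_compose_quotient_map[OF quot])
  then have cf: "continuous_on ?S (\<lambda>z. c (f z))" by (simp add: o_def)
  have df: "continuous_on ?S (\<lambda>z. d j (f z))" for j
  proof -
    have "continuous_on B (\<lambda>b. b j / \<theta> b ^ j)"
      by (intro continuous_on_divide continuous_on_power continuous_on_coordinate \<theta>_cont) (use \<theta>_nz in auto)
    then have "continuous_map (top_of_set B) euclidean (\<lambda>b. b j / \<theta> b ^ j)" by simp
    then have "continuous_map (top_of_set B) euclidean (d j \<circ> orb)"
      by (rule continuous_map_eq) (use d_orb in auto)
    then have "continuous_map (top_of_set ?S) euclidean (d j \<circ> f)"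
      by (intro continuous_map_compose[OF f] continuous_compose_quotient_map[OF quot])
    then show ?thesis by (simp add: o_def)
  qed
  have f_top: "f z \<in> topspace Y" if "z \<in> ?S" for z
    using continuous_map_image_subset_topspace[OF f] that by auto
  have "contractible ?S" by (intro convex_imp_contractible convex_Times) auto
  then obtain l where l: "continuous_on ?S l" "\<And>z. z \<in> ?S \<Longrightarrow> c (f z) = exp (l z)"
    using continuous_logarithm_on_contractible[OF cf] sec(1) f_top \<theta>_nz by (auto simp: c_def)
  \<comment> \<open>An \<open>r\<close>-th root of unity that corrects the root obtained from the
    logarithm, so that \<open>x (0, 0) = \<theta> a\<close> and the lift starts at
    \<open>a\<close>.\<close>
  define \<kappa> where "\<kappa> = \<theta> a / exp (l (0, 0) / of_nat r)"
  define x where "x z = \<kappa> * exp (l z / of_nat r)" for z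
  have exp_r: "exp (l z / of_nat r) ^ r = exp (l z)" for z
    using r by (simp add: exp_of_nat_mult[symmetric])
  have "\<kappa> ^ r = 1"
    using l(2)[of "(0, 0)"] c_orb[OF a(1)] a(2) exp_r[of "(0, 0)"] \<theta>_nz[OF a(1)] by (simp add: \<kappa>_def power_divide)
  then have x_r: "x z ^ r = c (f z)" if "z \<in> ?S" for z
    using l(2)[OF that] exp_r[of z] by (simp add: x_def power_mult_distrib)
  have x_cont: "continuous_on ?S x"
    unfolding x_def using r by (intro continuous_intros l(1)) auto
  define A where "A z = (\<lambda>j. d j (f z) * x z ^ j)" for z
  \<comment> \<open>Each \<open>r\<close>-th root \<open>x z\<close> is the value of
    \<open>\<theta>\<close> at some rotation of \<open>b\<close>; multiplying \<open>d j\<close> by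
    \<open>x z ^ j\<close> returns the coordinates of exactly that rotated point.\<close>
  have A_rot: "A z = rotate_coeffs r m b"
    if "b \<in> B" "orb b = f z" "x z = root_of_unity r m * \<theta> b" for z b m
  proof
    fix j
    show "A z j = rotate_coeffs r m b j"
      using d_orb[OF that(1), of j] \<theta>_nz[OF that(1)] that(2,3)
      by (simp add: A_def rotate_coeffs_def power_mult_distrib root_of_unity_power mult.commute)
  qed
  have "A z \<in> B \<and> orb (A z) = f z" if z: "z \<in> ?S" for z
  proof -
    let ?b = "sec (f z)"
    have b: "?b \<in> B" "orb ?b = f z" using sec f_top[OF z] by auto
    have "(x z / \<theta> ?b) ^ r = 1"
      using x_r[OF z] \<theta>_nz[OF b(1)] by (simp add: c_def power_divide)
    then obtain m where "x z / \<theta> ?b = root_of_unity r m"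
      using root_of_unity_surj[OF r] by blast
    then have "x z = root_of_unity r m * \<theta> ?b" using \<theta>_nz[OF b(1)] by (simp add: field_simps)
    then have Az: "A z = rotate_coeffs r m ?b" by (rule A_rot[OF b])
    then have "A z \<in> B" using b by simp
    then show ?thesis using orb_eq[OF b(1), of "A z"] Az b(2) by auto
  qed
  moreover have "A (0, 0) = a"
    using A_rot[OF a, of 0] by (simp add: x_def \<kappa>_def rotate_coeffs_def)
  moreover have "continuous_on ?S A"
    unfolding A_def by (intro continuous_on_coordinatewise_then_product continuous_on_mult df
        continuous_on_power x_cont)
  ultimately show thesis using that by blast
qed

text \<open>Once the map is lifted to the torus, its coordinates in \<open>M\<close> are nowhere
  zero on a contractible square and have continuous logarithms.\<close>

lemma square_lift:
  assumes f: "continuous_map (top_of_set ({0..1::real} \<times> {0..1::real})) Y f" and u: "u \<in> vanishing_on Z"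
    "orb (exp_map u) = f (0, 0)"
  shows "\<exists>F. continuous_on ({0..1::real} \<times> {0..1::real}) F \<and>
    (\<forall>z\<in>{0..1} \<times> {0..1}. F z \<in> vanishing_on Z \<and> orb (exp_map (F z)) = f z) \<and> F (0, 0) = u"
proof -
  let ?S = "{0..1::real} \<times> {0..1::real}"
  obtain A where A: "continuous_on ?S A" "\<And>z. z \<in> ?S \<Longrightarrow> A z \<in> B" "\<And>z. z \<in> ?S \<Longrightarrow> orb (A z) = f z"
    "A (0, 0) = exp_map u"
    using square_lift_to_B[OF f exp_map_in_B[OF u(1)] u(2)] by metis
  have Aj: "continuous_on ?S (\<lambda>z. A z j)" for j
    using A(1) by (rule continuous_on_product_then_coordinatewise)
  have "\<exists>g. continuous_on ?S g \<and> (\<forall>z\<in>?S. A z j = exp (g z))" if "j \<in> M" for j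
  proof -
    have "contractible ?S" by (intro convex_imp_contractible convex_Times) auto
    moreover have "A z j \<noteq> 0" if "z \<in> ?S" for z using A(2)[OF that] \<open>j \<in> M\<close> by (auto simp: torus_set_def)
    ultimately show ?thesis
      using continuous_logarithm_on_contractible[OF Aj[of j]] by metis
  qed
  then obtain g where g: "\<And>j. j \<in> M \<Longrightarrow> continuous_on ?S (g j)"
    "\<And>j z. j \<in> M \<Longrightarrow> z \<in> ?S \<Longrightarrow> A z j = exp (g j z)"
    by metis
  \<comment> \<open>The added constant is a period of the exponential, since \<open>u j\<close> and
    \<open>g j (0, 0)\<close> have the same exponential; it moves the start of the lift to
    \<open>u\<close>.\<close>
  define F where "F z = (\<lambda>j. if j \<in> M then g j z + (u j - g j (0, 0)) else A z j)" for z
  have "continuous_on ?S (\<lambda>z. F z j)" for j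
    using g(1)[of j] Aj[of j] by (cases "j \<in> M") (auto simp: F_def intro!: continuous_intros)
  then have "continuous_on ?S F" by (rule continuous_on_coordinatewise_then_product)
  moreover have "F z \<in> vanishing_on Z \<and> orb (exp_map (F z)) = f z" if z: "z \<in> ?S" for z
  proof
    show "F z \<in> vanishing_on Z"
      using A(2)[OF z] M(2) by (auto simp: vanishing_on_def F_def torus_set_def)
    have "exp_map (F z) j = A z j" for j
    proof (cases "j \<in> M")
      case True
      then have "exp (g j (0, 0)) = exp (u j)"
        using g(2)[of j "(0, 0)"] A(4) by (simp add: exp_map_def)
      then have "exp (F z j) = exp (g j z)"
        using True by (simp add: F_def exp_add exp_diff)
      then show ?thesis using True g(2)[OF True z] by (simp add: exp_map_def)
    qed (simp add: exp_map_def F_def)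
    then have "exp_map (F z) = A z" by blast
    then show "orb (exp_map (F z)) = f z" using A(3)[OF z] by simp
  qed
  moreover have "F (0, 0) = u" using A(4) by (auto simp: F_def exp_map_def)
  ultimately show ?thesis by blast
qed

lemma exp_deck:
  assumes "int r dvd h + k"
  shows "exp (2 * of_real pi * \<i> / of_nat r * of_int h) = root_of_unity r k"
proof -
  have "root_of_unity r (- h) = root_of_unity r k"
    using assms by (intro root_of_unity_cong r) (metis add.commute diff_minus_eq_add dvd_minus_iff minus_diff_eq)
  then show ?thesis by (simp add: root_of_unity_def)
qed

text \<open>Points with the same image differ by a rotation by some \<open>m\<close> followed by
  periods of the exponential; in the unit \<open>2 pi i / r\<close> their logarithms differ by
  \<open>r n - m j\<close>, which is the shape of \<open>deck\<close>.\<close>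

sublocale vector_space_cover Y "orb \<circ> exp_map" Z M "2 * of_real pi * \<i> / of_nat r" deck
proof
  have "continuous_on (vanishing_on Z) exp_map"
  proof (rule continuous_on_coordinatewise_then_product)
    fix j
    show "continuous_on (vanishing_on Z) (\<lambda>u. exp_map u j)"
      by (cases "j \<in> M") (auto simp: exp_map_def intro!: continuous_on_exp continuous_on_coordinate)
  qed
  then have "continuous_map (top_of_set (vanishing_on Z)) (top_of_set B) exp_map"
    using exp_map_in_B by auto
  then show "continuous_map (top_of_set (vanishing_on Z)) Y (orb \<circ> exp_map)"
    by (rule continuous_map_compose) (rule quotient_imp_continuous_map[OF quot])
next
  fix f u assume "continuous_map (top_of_set ({0..1::real} \<times> {0..1::real})) Y f" "u \<in> vanishing_on Z"
    "(orb \<circ> exp_map) u = f (0, 0)"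
  then show "\<exists>F. continuous_on ({0..1::real} \<times> {0..1::real}) F \<and>
      (\<forall>z\<in>{0..1} \<times> {0..1}. F z \<in> vanishing_on Z \<and> (orb \<circ> exp_map) (F z) = f z) \<and> F (0, 0) = u"
    using square_lift by auto
next
  show "2 * complex_of_real pi * \<i> / of_nat r \<noteq> 0" using r by simp
next
  show "h j = 0" if "h \<in> deck" "j \<notin> M" for h j using that by (auto simp: deck_def)
next
  show "(\<lambda>j. h j + k j) \<in> deck" if "h \<in> deck" "k \<in> deck" for h k
    using int_lattice_add[OF int_lattice_deck that] .
next
  fix u v assume uv: "u \<in> vanishing_on Z" "v \<in> vanishing_on Z" "(orb \<circ> exp_map) u = (orb \<circ> exp_map) v"
  then obtain m where m: "exp_map v = rotate_coeffs r m (exp_map u)"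
    using orb_eq[of "exp_map u" "exp_map v"] exp_map_in_B by auto
  have m_nth: "exp_map v j = root_of_unity r (m * int j) * exp_map u j" for j
    using fun_cong[OF m, of j] by (simp add: rotate_coeffs_def)
  have "\<exists>n::int. v j - u j = 2 * of_real pi * \<i> / of_nat r * of_int (int r * n - m * int j)"
    if "j \<in> M" for j
  proof -
    have "exp (v j) = exp (u j - 2 * of_real pi * \<i> * of_int (m * int j) / of_nat r)"
      using m_nth[of j] that by (simp add: exp_map_def root_of_unity_def exp_diff exp_minus field_simps)
    then obtain n :: int where n: "v j = u j - 2 * of_real pi * \<i> * of_int (m * int j) / of_nat r
        + (of_int (2 * n) * pi) * \<i>"
      by (auto simp: exp_eq)
    then have "v j - u j = 2 * of_real pi * \<i> / of_nat r * of_int (int r * n - m * int j)"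
      using r by (simp add: field_simps)
    then show ?thesis by blast
  qed
  then obtain n where n: "\<And>j. j \<in> M \<Longrightarrow>
      v j - u j = 2 * of_real pi * \<i> / of_nat r * of_int (int r * n j - m * int j)" by metis
  show "\<exists>h\<in>deck. \<forall>j\<in>M. v j - u j = 2 * of_real pi * \<i> / of_nat r * of_int (h j)"
  proof (rule bexI[of _ "\<lambda>j. if j \<in> M then int r * n j - m * int j else 0"])
    show "(\<lambda>j. if j \<in> M then int r * n j - m * int j else 0) \<in> deck"
      by (auto simp: deck_def intro!: exI[of _ m])
  qed (use n in auto)
  assume eq: "\<And>j. j \<in> M \<Longrightarrow> u j = v j"
  \<comment> \<open>Agreement on \<open>M\<close> means that the rotation fixes nonzero coordinates
    there, so by \<open>faithful\<close> it is trivial and the other coordinates agree too.\<close>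
  have "int r dvd m"
  proof (rule faithful)
    fix j assume "j \<in> M"
    then show "int r dvd m * int j"
      using m_nth[of j] eq[of j] root_of_unity_eq_1_iff[OF r, of "m * int j"] by (simp add: exp_map_def)
  qed
  then have root1: "root_of_unity r (m * int j) = 1" for j
    using root_of_unity_eq_1_iff[OF r] by simp
  show "u = v"
  proof
    fix j show "u j = v j"
      using eq[of j] m_nth[of j] root1[of j] by (cases "j \<in> M") (auto simp: exp_map_def)
  qed
next
  fix u h assume u: "u \<in> vanishing_on Z" and h: "h \<in> deck"
  then obtain m where m: "\<And>j. j \<in> M \<Longrightarrow> int r dvd h j + m * int j" by (auto simp: deck_def)
  \<comment> \<open>Outside \<open>M\<close> the map \<open>exp_map\<close> is the identity, so the
    rotation by \<open>m\<close> that \<open>h\<close> induces on the exponentials has to be applied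
    directly.\<close>
  define v where "v = (\<lambda>j. if j \<in> M then u j + 2 * of_real pi * \<i> / of_nat r * of_int (h j)
      else root_of_unity r (m * int j) * u j)"
  have v: "v \<in> vanishing_on Z" using u M(2) by (auto simp: v_def vanishing_on_def)
  have "exp_map v = rotate_coeffs r m (exp_map u)"
  proof
    fix j show "exp_map v j = rotate_coeffs r m (exp_map u) j"
      using exp_deck[OF m, of j] by (simp add: exp_map_def v_def rotate_coeffs_def exp_add)
  qed
  then have "orb (exp_map u) = orb (exp_map v)"
    using orb_eq[OF exp_map_in_B[OF u] exp_map_in_B[OF v]] by blast
  then show "\<exists>v\<in>vanishing_on Z. (orb \<circ> exp_map) v = (orb \<circ> exp_map) u \<and>
      (\<forall>j\<in>M. v j - u j = 2 * of_real pi * \<i> / of_nat r * of_int (h j))"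
    using v by (intro bexI[of _ v]) (auto simp: v_def)
qed

theorem fundamental_group_iso_Zpow:
  assumes "a \<in> B"
  shows "fundamental_group Y (orb a) \<cong> Zpow (card M)"
proof -
  obtain u where u: "u \<in> vanishing_on Z" "exp_map u = a"
    using exp_map_surj[OF assms] .
  show ?thesis
    using iso_trans[OF fundamental_group_iso[OF u(1)] deck_iso_Zpow] u(2) by simp
qed

end

section \<open>Exponential factors\<close>

text \<open>The open sets of \<open>quotient_topology\<close> can be read off its definition only
  after \<open>istopology\<close> has been checked.\<close>

lemma quotient_map_quotient_topology: "quotient_map X (quotient_topology X f) f"
proof -
  let ?P = "\<lambda>U. U \<subseteq> f ` topspace X \<and> openin X {x \<in> topspace X. f x \<in> U}"
  have "istopology ?P"
    unfolding istopology_def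
  proof (intro conjI allI impI)
    fix S T assume "?P S" "?P T"
    moreover have "{x \<in> topspace X. f x \<in> S \<inter> T} = {x \<in> topspace X. f x \<in> S} \<inter> {x \<in> topspace X. f x \<in> T}"
      by auto
    ultimately show "S \<inter> T \<subseteq> f ` topspace X" "openin X {x \<in> topspace X. f x \<in> S \<inter> T}"
      by auto
  next
    fix \<K> assume K: "\<forall>K\<in>\<K>. ?P K"
    have "{x \<in> topspace X. f x \<in> \<Union>\<K>} = (\<Union>K\<in>\<K>. {x \<in> topspace X. f x \<in> K})" by auto
    then show "openin X {x \<in> topspace X. f x \<in> \<Union>\<K>}" using K by auto
    show "\<Union>\<K> \<subseteq> f ` topspace X" using K by auto
  qed
  then have op: "openin (quotient_topology X f) U \<longleftrightarrow> ?P U" for U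
    unfolding quotient_topology_def by (simp add: topology_inverse')
  have "topspace (quotient_topology X f) = f ` topspace X"
  proof
    show "topspace (quotient_topology X f) \<subseteq> f ` topspace X"
      using op[of "topspace (quotient_topology X f)"] by simp
    have "{x \<in> topspace X. f x \<in> f ` topspace X} = topspace X" by auto
    then show "f ` topspace X \<subseteq> topspace (quotient_topology X f)"
      using op[of "f ` topspace X"] by (simp add: openin_subset)
  qed
  then show ?thesis unfolding quotient_map_def op by auto
qed

section \<open>The Galois operator on coefficients\<close>

lemma inv_sigma:
  "inv_into UNIV sigma = (\<lambda>q k. exp (2 * of_real pi * \<i> * of_real (of_rat k)) * q k)"
proof (rule inv_unique_comp)
  show "sigma \<circ> (\<lambda>q k. exp (2 * of_real pi * \<i> * of_real (of_rat k)) * q k) = id"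
    by (simp add: sigma_def fun_eq_iff exp_minus)
  show "(\<lambda>q k. exp (2 * of_real pi * \<i> * of_real (of_rat k)) * q k) \<circ> sigma = id"
    by (simp add: sigma_def fun_eq_iff exp_minus)
qed

lemma sigma_int_apply:
  "sigma_int i q x = exp (- (2 * of_real pi * \<i> * of_int i * of_real (of_rat x))) * q x"
proof (cases "i \<ge> 0")
  case True
  have "(sigma ^^ n) q x = exp (- (2 * of_real pi * \<i> * of_nat n * of_real (of_rat x))) * q x" for n
    by (induction n) (simp_all add: sigma_def algebra_simps exp_add exp_minus exp_diff divide_inverse)
  from this[of "nat i"] True show ?thesis by (simp add: sigma_int_def)
next
  case False
  have "(inv_into UNIV sigma ^^ n) q x = exp (2 * of_real pi * \<i> * of_nat n * of_real (of_rat x)) * q x" for n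
    by (induction n) (simp_all add: inv_sigma algebra_simps exp_add)
  from this[of "nat (- i)"] False show ?thesis by (simp add: sigma_int_def)
qed

lemma sigma_int_apply_fraction:
  "sigma_int i q (of_nat j / of_nat r) = root_of_unity r (i * int j) * q (of_nat j / of_nat r)"
  by (simp add: sigma_int_apply root_of_unity_def of_rat_divide mult.assoc)

lemma funpow_sigma: "sigma ^^ k = sigma_int (int k)"
  by (simp add: sigma_int_def)

lemma q_of_fraction:
  assumes "r > 0" "j \<in> {1..s}"
  shows "q_of r s a (of_nat j / of_nat r) = a j"
proof -
  have "(THE i. i \<in> {1..s} \<and> (of_nat j / of_nat r :: rat) = of_nat i / of_nat r) = j"
    using assms by (intro the_equality) auto
  then show ?thesis using assms by (auto simp: q_of_def)
qed

lemma q_of_other: "(\<And>j. j \<in> {1..s} \<Longrightarrow> k \<noteq> of_nat j / of_nat r) \<Longrightarrow> q_of r s a k = 0"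
  by (auto simp: q_of_def)

text \<open>The numerators over \<open>r\<close> of the exponents in the support of
  \<open>q_a - sigma^d q_a\<close>.\<close>

definition moved :: "nat \<Rightarrow> nat \<Rightarrow> (nat \<Rightarrow> complex) \<Rightarrow> int \<Rightarrow> nat set" where
  "moved r s a d = {j \<in> {1..s}. a j \<noteq> 0 \<and> \<not> int r dvd d * int j}"

text \<open>Up to the factor \<open>1/r\<close> this is the slope of \<open>q\<^sub>a - \<sigma>\<^sup>d q\<^sub>a\<close>.\<close>
definition top_moved :: "nat \<Rightarrow> nat \<Rightarrow> (nat \<Rightarrow> complex) \<Rightarrow> int \<Rightarrow> nat" where
  "top_moved r s a d = Max (insert 0 (moved r s a d))"

lemma finite_moved [simp]: "finite (moved r s a d)"
  by (simp add: moved_def)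

lemma top_moved_in: "top_moved r s a d \<noteq> 0 \<Longrightarrow> top_moved r s a d \<in> moved r s a d"
  using Max_in[of "insert 0 (moved r s a d)"] by (auto simp: top_moved_def)

lemma top_moved_ge: "j \<in> moved r s a d \<Longrightarrow> j \<le> top_moved r s a d"
  by (simp add: top_moved_def)

text \<open>Lets the finitely many conditions in \<open>Bset\<close> speak about all integers
  \<open>d\<close>.\<close>

lemma top_moved_mod: "top_moved r s a (d mod int r) = top_moved r s a d"
proof -
  have "int r dvd d mod int r * x \<longleftrightarrow> int r dvd d * x" for x
    by (metis dvd_eq_mod_eq_0 mod_mult_left_eq)
  then show ?thesis by (simp add: top_moved_def moved_def)
qed

text \<open>The inserted 0 matches the convention that the zero factor has slope 0 and leaves the
  maximum of a nonempty set unchanged.\<close>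

lemma slope_fraction_support:
  assumes "r > 0" "finite L" "{x. f x \<noteq> 0} = (\<lambda>j. of_nat j / of_nat r) ` L"
  shows "slope f = of_nat (Max (insert 0 L)) / of_nat r"
proof (cases "L = {}")
  case True
  then show ?thesis using assms by (simp add: slope_def)
next
  case False
  have "mono (\<lambda>j. of_nat j / of_nat r :: rat)"
    by (rule monoI) (simp add: divide_right_mono)
  then have "Max ((\<lambda>j. of_nat j / of_nat r :: rat) ` L) = of_nat (Max L) / of_nat r"
    using mono_Max_commute[OF _ assms(2) False] by metis
  moreover have "Max (insert 0 L) = Max L" using False assms(2) by simp
  ultimately show ?thesis using False assms by (simp add: slope_def)
qed

text \<open>The common nonzero factor \<open>root_of_unity r (l * int j)\<close> splits off each
  coefficient, so a condition on pairs becomes one on the integer \<open>k - l\<close>.\<close>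

lemma slope_sigma_diff:
  assumes "r > 0"
  shows "slope (\<lambda>x. sigma_int k (q_of r s a) x - sigma_int l (q_of r s a) x)
    = of_nat (top_moved r s a (k - l)) / of_nat r"
  unfolding top_moved_def
proof (rule slope_fraction_support[OF assms])
  have eq: "root_of_unity r (k * int j) = root_of_unity r (l * int j) \<longleftrightarrow> int r dvd (k - l) * int j" for j
  proof -
    have "root_of_unity r (k * int j) = root_of_unity r ((k - l) * int j) * root_of_unity r (l * int j)"
      by (simp add: root_of_unity_add[symmetric] algebra_simps)
    then show ?thesis using root_of_unity_eq_1_iff[OF assms, of "(k - l) * int j"] by auto
  qed
  have nz: "sigma_int k (q_of r s a) (of_nat j / of_nat r) - sigma_int l (q_of r s a) (of_nat j / of_nat r) \<noteq> 0
      \<longleftrightarrow> j \<in> moved r s a (k - l)" if "j \<in> {1..s}" for j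
    unfolding sigma_int_apply_fraction q_of_fraction[OF assms that]
    using that eq[of j] by (auto simp: moved_def)
  show "{x. sigma_int k (q_of r s a) x - sigma_int l (q_of r s a) x \<noteq> 0} =
      (\<lambda>j. of_nat j / of_nat r) ` moved r s a (k - l)" (is "?A = ?B")
  proof
    show "?B \<subseteq> ?A" using nz by (auto simp: moved_def)
    show "?A \<subseteq> ?B"
    proof
      fix x assume x: "x \<in> ?A"
      then have "q_of r s a x \<noteq> 0" by (auto simp: sigma_int_apply)
      then obtain j where "j \<in> {1..s}" "x = of_nat j / of_nat r" using q_of_other by metis
      then show "x \<in> ?B" using x nz by auto
    qed
  qed
qed simp

text \<open>The product of the reduced denominators over the finite support works; hence the
  \<open>LEAST\<close> in \<open>ram\<close> is attained.\<close>

lemma common_denominator: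
  assumes "exp_factor q"
  shows "\<exists>r. r \<ge> 1 \<and> (\<forall>k. q k \<noteq> 0 \<longrightarrow> (\<exists>j::nat. j \<ge> 1 \<and> k = of_nat j / of_nat r))"
proof -
  let ?S = "{k. q k \<noteq> 0}"
  let ?b = "\<lambda>k. nat (snd (quotient_of k))"
  have fin: "finite ?S" and pos: "\<And>k. q k \<noteq> 0 \<Longrightarrow> k > 0"
    using assms by (auto simp: exp_factor_def)
  have b: "?b k > 0" for k using quotient_of_denom_pos'[of k] by simp
  let ?D = "\<Prod>k\<in>?S. ?b k"
  have D: "?D > 0" using b by (simp add: prod_pos)
  have "\<exists>j::nat. j \<ge> 1 \<and> k = of_nat j / of_nat ?D" if k: "q k \<noteq> 0" for k
  proof -
    obtain n d where nd: "quotient_of k = (n, d)" by (cases "quotient_of k")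
    have kd: "k = of_int n / of_int d" "d > 0"
      using quotient_of_div[OF nd] quotient_of_denom_pos[OF nd] by auto
    have n: "n > 0" using pos[OF k] kd by (simp add: zero_less_divide_iff)
    have "nat d dvd ?D" using k nd fin dvd_prodI[of ?S k ?b] by simp
    then obtain e where e: "?D = nat d * e" by blast
    have e0: "e > 0" using e D by (cases e) auto
    have "k = of_nat (nat n * e) / of_nat ?D"
      unfolding e kd(1) using e0 kd(2) n by simp
    moreover have "nat n * e \<ge> 1" using n e0 by (simp add: Suc_le_eq)
    ultimately show ?thesis by blast
  qed
  with D show ?thesis by (intro exI[of _ ?D]) auto
qed

lemma funpow_sigma_coef: "(sigma_coef n ^^ k) a = rotate_coeffs n (int k) a"
proof (induction k)
  case (Suc k)
  have "sigma_coef n (rotate_coeffs n (int k) a) j = rotate_coeffs n (int (Suc k)) a j" for j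
    using root_of_unity_add[of n "int j" "int k * int j"]
    by (simp add: sigma_coef_def rotate_coeffs_def root_of_unity_def[of n "int j"] algebra_simps)
  with Suc show ?case by auto
qed (simp add: rotate_coeffs_def)

section \<open>Ramification, levels and the coordinate form of the space\<close>

locale exponential_factor =
  fixes q :: "rat \<Rightarrow> complex"
  assumes exp_factor: "exp_factor q"
begin

abbreviation "r \<equiv> ram q"
abbreviation "s \<equiv> sdim q"

lemma ram_pos: "r > 0"
  and ram_support: "\<And>k. q k \<noteq> 0 \<Longrightarrow> \<exists>j::nat. j \<ge> 1 \<and> k = of_nat j / of_nat r"
proof -
  have "r \<ge> 1 \<and> (\<forall>k. q k \<noteq> 0 \<longrightarrow> (\<exists>j::nat. j \<ge> 1 \<and> k = of_nat j / of_nat r))"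
    unfolding ram_def by (rule LeastI_ex[OF common_denominator[OF exp_factor]])
  then show "r > 0" "\<And>k. q k \<noteq> 0 \<Longrightarrow> \<exists>j::nat. j \<ge> 1 \<and> k = of_nat j / of_nat r"
    by simp_all
qed

lemma ram_le:
  assumes "n \<ge> 1" "\<And>k. q k \<noteq> 0 \<Longrightarrow> \<exists>j::nat. j \<ge> 1 \<and> k = of_nat j / of_nat n"
  shows "r \<le> n"
proof -
  have "n \<ge> 1 \<and> (\<forall>k. q k \<noteq> 0 \<longrightarrow> (\<exists>j::nat. j \<ge> 1 \<and> k = of_nat j / of_nat n))"
    using assms by blast
  then show ?thesis unfolding ram_def by (rule Least_le)
qed

text \<open>For nonzero \<open>q\<close> the slope is itself an exponent, thus a multiple of
  \<open>1/r\<close>; the rounding in \<open>sdim\<close> loses nothing and \<open>s\<close> is the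
  largest numerator.\<close>

lemma support:
  assumes "q k \<noteq> 0"
  obtains j where "j \<in> {1..s}" "k = of_nat j / of_nat r"
proof -
  let ?S = "{k. q k \<noteq> 0}"
  have fin: "finite ?S" using exp_factor by (simp add: exp_factor_def)
  have "slope q \<in> ?S" using assms fin Max_in[of ?S] by (auto simp: slope_def)
  then obtain t where t: "slope q = of_nat t / of_nat r" using ram_support by blast
  have s: "s = t" using ram_pos by (simp add: sdim_def t)
  obtain j where j: "j \<ge> 1" "k = of_nat j / of_nat r" using ram_support[OF assms] by blast
  have "k \<le> slope q" using assms fin by (auto simp: slope_def)
  then have "j \<le> t" using j t ram_pos by (simp add: divide_le_cancel)
  with j s that show thesis by auto
qed

definition coeffs :: "nat \<Rightarrow> complex" where
  "coeffs j = (if j \<in> {1..s} then q (of_nat j / of_nat r) else 0)"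

lemma q_of_coeffs: "q_of r s coeffs = q"
proof
  fix k
  show "q_of r s coeffs k = q k"
  proof (cases "\<exists>j\<in>{1..s}. k = of_nat j / of_nat r")
    case True
    then show ?thesis using q_of_fraction[OF ram_pos] by (auto simp: coeffs_def)
  next
    case False
    then have "q k = 0" using support by metis
    then show ?thesis using False q_of_other by metis
  qed
qed

definition levels :: "nat set" where
  "levels = range (top_moved r s coeffs) - {0}"

text \<open>If some \<open>sigma^d\<close> moves \<open>x^(j/r)\<close> although the slope
  prescribed for \<open>d\<close> is below \<open>j/r\<close>, a nonzero coefficient at
  \<open>j\<close> would make the slope too large.\<close>

definition zeros :: "nat set" where
  "zeros = {j. j \<notin> {1..s} \<or> (\<exists>d. top_moved r s coeffs d < j \<and> \<not> int r dvd d * int j)}"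

lemma levels_moved: "j \<in> levels \<Longrightarrow> \<exists>d. j = top_moved r s coeffs d \<and> j \<in> moved r s coeffs d"
  using top_moved_in[of r s coeffs] by (auto simp: levels_def)

lemma finite_levels: "finite levels"
proof (rule finite_subset)
  show "levels \<subseteq> {1..s}"
    using levels_moved unfolding moved_def by blast
qed simp

lemma Levels_eq: "Levels q = (\<lambda>j. of_nat j / of_nat r) ` levels"
proof -
  \<comment> \<open>The difference has the form \<open>sigma^0 q - sigma^i q\<close>, hence the
    index \<open>- i\<close>; the sign disappears when \<open>i\<close> ranges over all
    integers.\<close>
  have "slope (\<lambda>k. q k - sigma_int i q k) = of_nat (top_moved r s coeffs (- i)) / of_nat r" for i
    using slope_sigma_diff[OF ram_pos, of 0 s coeffs i] by (simp add: q_of_coeffs sigma_int_apply[of 0])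
  then have "Levels q = {of_nat (top_moved r s coeffs (- i)) / of_nat r | i. True} - {0}"
    by (simp add: Levels_def)
  also have "\<dots> = (\<lambda>j. of_nat j / of_nat r) ` levels"
  proof -
    have "of_nat (top_moved r s coeffs d) / of_nat r \<in> {of_nat (top_moved r s coeffs (- i)) / of_nat r | i. True}" for d
      by (rule CollectI) (rule exI[of _ "- d"], simp)
    then show ?thesis using ram_pos by (auto simp: levels_def)
  qed
  finally show ?thesis .
qed

lemma card_Levels: "card (Levels q) = card levels"
proof -
  have "inj_on (\<lambda>j. of_nat j / of_nat r :: rat) levels"
    using ram_pos by (simp add: inj_on_def)
  then show ?thesis unfolding Levels_eq by (rule card_image)
qed

text \<open>Pairs with \<open>l = 0\<close> realise every residue class modulo \<open>r\<close>, and
  \<open>top_moved\<close> depends only on that class.\<close>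

lemma Bset_iff:
  "a \<in> Bset q \<longleftrightarrow> (\<forall>j. j \<notin> {1..s} \<longrightarrow> a j = 0) \<and> (\<forall>d. top_moved r s a d = top_moved r s coeffs d)"
proof -
  have slope_eq: "slope (\<lambda>x. (sigma ^^ k) (q_of r s a) x - (sigma ^^ l) (q_of r s a) x)
       = slope (\<lambda>x. (sigma ^^ k) q x - (sigma ^^ l) q x) \<longleftrightarrow>
      top_moved r s a (int k - int l) = top_moved r s coeffs (int k - int l)" for k l
    using slope_sigma_diff[OF ram_pos, of "int k" s a "int l"]
      slope_sigma_diff[OF ram_pos, of "int k" s coeffs "int l"] ram_pos
    by (simp add: q_of_coeffs funpow_sigma)
  have "top_moved r s a d = top_moved r s coeffs d"
    if "\<forall>k\<in>{0..r}. \<forall>l\<in>{0..r}. top_moved r s a (int k - int l) = top_moved r s coeffs (int k - int l)" for d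
  proof -
    have "nat (d mod int r) \<in> {0..r}" "int (nat (d mod int r)) = d mod int r"
      using ram_pos by (auto simp: nat_le_iff less_imp_le)
    then have "top_moved r s a (d mod int r) = top_moved r s coeffs (d mod int r)"
      using that[rule_format, of "nat (d mod int r)" 0] by simp
    then show ?thesis by (simp add: top_moved_mod)
  qed
  then show ?thesis unfolding Bset_def mem_Collect_eq slope_eq by blast
qed

text \<open>Prescribing a maximum is two independent conditions: nothing moved lies above it, which
  gives \<open>zeros\<close>, and it is attained, which gives \<open>levels\<close>.\<close>

lemma Bset_eq: "Bset q = torus_set zeros levels"
proof
  show "Bset q \<subseteq> torus_set zeros levels"
  proof
    fix a assume "a \<in> Bset q"
    then have a: "\<And>j. j \<notin> {1..s} \<Longrightarrow> a j = 0" "\<And>d. top_moved r s a d = top_moved r s coeffs d"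
      by (auto simp: Bset_iff)
    have "a j = 0" if "j \<in> zeros" for j
    proof (rule ccontr)
      assume "a j \<noteq> 0"
      with a(1) that obtain d where "j \<in> {1..s}" "top_moved r s coeffs d < j" "\<not> int r dvd d * int j"
        by (auto simp: zeros_def)
      then show False using top_moved_ge[of j r s a d] a(2)[of d] \<open>a j \<noteq> 0\<close> by (auto simp: moved_def)
    qed
    moreover have "a j \<noteq> 0" if "j \<in> levels" for j
    proof -
      obtain d where "j = top_moved r s a d" "j \<noteq> 0" using \<open>j \<in> levels\<close> a(2) by (auto simp: levels_def)
      then have "j \<in> moved r s a d" using top_moved_in by metis
      then show ?thesis by (simp add: moved_def)
    qed
    ultimately show "a \<in> torus_set zeros levels" by (simp add: torus_set_def)
  qed
  show "torus_set zeros levels \<subseteq> Bset q"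
  proof
    fix a assume "a \<in> torus_set zeros levels"
    then have a: "\<And>j. j \<in> zeros \<Longrightarrow> a j = 0" "\<And>j. j \<in> levels \<Longrightarrow> a j \<noteq> 0"
      by (auto simp: torus_set_def)
    have "top_moved r s a d = top_moved r s coeffs d" for d
    proof (rule antisym)
      show "top_moved r s a d \<le> top_moved r s coeffs d"
      proof (rule ccontr)
        assume less: "\<not> ?thesis"
        then have "top_moved r s a d \<in> moved r s a d" by (intro top_moved_in) simp
        then have "a (top_moved r s a d) \<noteq> 0" "top_moved r s a d \<in> zeros"
          using less by (auto simp: moved_def zeros_def not_le intro!: exI[of _ d])
        then show False using a(1) by simp
      qed
      show "top_moved r s coeffs d \<le> top_moved r s a d"
      proof (cases "top_moved r s coeffs d = 0")
        case False
        let ?j = "top_moved r s coeffs d"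
        have "?j \<in> moved r s coeffs d" using False by (rule top_moved_in)
        moreover have "?j \<in> levels" using False by (auto simp: levels_def)
        ultimately have "?j \<in> moved r s a d" using a(2)[of ?j] by (auto simp: moved_def)
        then show ?thesis by (rule top_moved_ge)
      qed simp
    qed
    moreover have "a j = 0" if "j \<notin> {1..s}" for j using a(1) that by (simp add: zeros_def)
    ultimately show "a \<in> Bset q" by (auto simp: Bset_iff)
  qed
qed

text \<open>The coefficients of \<open>q\<close> satisfy both kinds of conditions, so no index is
  subject to both.\<close>

lemma levels_zeros_disjoint: "levels \<inter> zeros = {}"
proof -
  have "coeffs \<in> Bset q" by (auto simp: Bset_iff coeffs_def)
  then show ?thesis by (auto simp: Bset_eq torus_set_def)
qed

text \<open>If \<open>sigma^m\<close> moved \<open>q\<close>, the top moved index would be a level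
  violating the assumption; so \<open>sigma^m\<close> fixes \<open>q\<close>. Then
  \<open>gcd m r\<close> is an admissible denominator for all exponents, and minimality of
  \<open>ram\<close> forces it to be \<open>r\<close>.\<close>

lemma levels_faithful:
  assumes "\<And>j. j \<in> levels \<Longrightarrow> int r dvd m * int j"
  shows "int r dvd m"
proof -
  define g where "g = nat (gcd m (int r))"
  have g: "int g = gcd m (int r)" "g \<ge> 1"
    using ram_pos by (auto simp: g_def Suc_le_eq)
  have "top_moved r s coeffs m = 0"
  proof (rule ccontr)
    assume "top_moved r s coeffs m \<noteq> 0"
    then show False
      using top_moved_in[of r s coeffs m] assms[of "top_moved r s coeffs m"]
      by (auto simp: levels_def moved_def)
  qed
  then have "moved r s coeffs m \<subseteq> {0}" using top_moved_ge by fastforce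
  then have dvd: "int r dvd m * int j" if "j \<in> {1..s}" "coeffs j \<noteq> 0" for j
    using that by (auto simp: moved_def)
  \<comment> \<open>After division by \<open>g\<close> the cofactors are coprime, so
    \<open>r'\<close> divides each numerator \<open>j\<close>, and \<open>j / r\<close> reduces to a
    fraction over \<open>g\<close>.\<close>
  obtain r' where r': "int r = int g * r'" using g(1) by (metis dvd_def gcd_dvd2)
  obtain m' where m': "m = int g * m'" using g(1) by (metis dvd_def gcd_dvd1)
  have "coprime m' r'"
  proof -
    have "int g * gcd m' r' = int g * 1"
      using g(1) gcd_mult_distrib_int[of "int g" m' r'] r' m' by simp
    then show ?thesis using g(2) by (simp add: coprime_iff_gcd_eq_1)
  qed
  have "r \<le> g"
  proof (rule ram_le[OF g(2)])
    fix k assume k: "q k \<noteq> 0"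
    then obtain j where j: "j \<in> {1..s}" "k = of_nat j / of_nat r" using support by blast
    then have "int r dvd m * int j" using dvd[of j] k by (simp add: coeffs_def)
    then have "r' dvd m' * int j" using g(2) unfolding r' m' by (simp add: mult.assoc)
    then have "r' dvd int j"
      using \<open>coprime m' r'\<close> by (simp add: coprime_commute coprime_dvd_mult_right_iff)
    then obtain i where i: "int j = r' * i" by blast
    have "0 < int g * r'" using r' ram_pos by (metis of_nat_0_less_iff)
    then have r'_pos: "r' > 0" using g(2) by (simp add: zero_less_mult_iff)
    have "0 < r' * i" using i j(1) by (simp flip: i)
    then have "i > 0" using r'_pos by (simp add: zero_less_mult_iff)
    have "(of_nat j :: rat) = of_int r' * of_int i" "(of_nat r :: rat) = of_nat g * of_int r'"
      using i r' by (metis of_int_mult of_int_of_nat_eq)+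
    then have "k = of_nat (nat i) / of_nat g"
      using j(2) r'_pos \<open>i > 0\<close> by simp
    then show "\<exists>j::nat. j \<ge> 1 \<and> k = of_nat j / of_nat g"
      using \<open>i > 0\<close> by (intro exI[of _ "nat i"]) auto
  qed
  moreover have "g dvd r" using g(1) by (metis gcd_dvd2 int_dvd_int_iff)
  ultimately have "g = r" using ram_pos dvd_imp_le[of g r] by simp
  then show ?thesis using g(1) by (metis gcd_dvd1)
qed

section \<open>The cyclic action, its orbits and the two covers\<close>

lemma Bact_eq: "m \<ge> 0 \<Longrightarrow> Bact q m = (\<lambda>a\<in>Bset q. rotate_coeffs r m a)"
  by (simp add: Bact_def funpow_sigma_coef)

lemma rotate_coeffs_Bset [simp]: "rotate_coeffs n m a \<in> Bset q \<longleftrightarrow> a \<in> Bset q"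
  by (simp add: Bset_eq)

lemma carrier_mod: "carrier (integer_mod_group r) = {0..<int r}"
  using ram_pos by (simp add: carrier_integer_mod_group)

lemma Bact_group_action: "group_action (integer_mod_group r) (Bset q) (Bact q)"
proof -
  have bij: "Bact q m \<in> Bij (Bset q)" if "m \<ge> 0" for m
  proof -
    have "bij_betw (rotate_coeffs r m) (Bset q) (Bset q)"
      by (rule bij_betwI[where g = "rotate_coeffs r (- m)"])
        (auto simp: rotate_coeffs_add[symmetric] rotate_coeffs_0)
    then have "bij_betw (\<lambda>a\<in>Bset q. rotate_coeffs r m a) (Bset q) (Bset q)"
      by (simp cong: bij_betw_cong)
    then show ?thesis using that by (simp add: Bij_def Bact_eq)
  qed
  have "Bact q \<in> hom (integer_mod_group r) (BijGroup (Bset q))"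
  proof (rule homI)
    fix x assume "x \<in> carrier (integer_mod_group r)"
    then show "Bact q x \<in> carrier (BijGroup (Bset q))" using bij by (simp add: BijGroup_def carrier_mod)
  next
    fix x y assume "x \<in> carrier (integer_mod_group r)" "y \<in> carrier (integer_mod_group r)"
    then have xy: "x \<ge> 0" "y \<ge> 0" by (auto simp: carrier_mod)
    have "Bact q ((x + y) mod int r) = compose (Bset q) (Bact q x) (Bact q y)"
      using xy ram_pos
      by (auto simp: Bact_eq compose_def rotate_coeffs_mod[OF ram_pos] rotate_coeffs_add fun_eq_iff)
    then show "Bact q (x \<otimes>\<^bsub>integer_mod_group r\<^esub> y) = Bact q x \<otimes>\<^bsub>BijGroup (Bset q)\<^esub> Bact q y"
      using bij xy by (simp add: BijGroup_def)
  qed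
  then show ?thesis
    by (simp add: group_action_def group_hom_def group_hom_axioms_def group_BijGroup)
qed

text \<open>Coordinates at levels are nonzero, so a fixed point gives \<open>r dvd m * j\<close> for
  every level \<open>j\<close>.\<close>

lemma Bact_free:
  assumes "m \<in> carrier (integer_mod_group r)" "a \<in> Bset q" "Bact q m a = a"
  shows "m = 0"
proof -
  have m: "0 \<le> m" "m < int r" using assms(1) by (auto simp: carrier_mod)
  have "int r dvd m"
  proof (rule levels_faithful)
    fix j assume "j \<in> levels"
    then have "a j \<noteq> 0" using assms(2) by (simp add: Bset_eq torus_set_def)
    moreover have "root_of_unity r (m * int j) * a j = a j"
      using fun_cong[OF assms(3), of j] assms(2) m by (simp add: Bact_eq rotate_coeffs_def)
    ultimately show "int r dvd m * int j" using root_of_unity_eq_1_iff[OF ram_pos] by simp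
  qed
  then show ?thesis using m by (meson zdvd_imp_le order_less_le not_le)
qed

text \<open>Rotation depends on \<open>m\<close> modulo \<open>r\<close> only, so residues can be
  replaced by all integers, for which comparing orbits is a shift of the index.\<close>

lemma orbit_eq: "a \<in> Bset q \<Longrightarrow> orbit (integer_mod_group r) (Bact q) a = range (\<lambda>m. rotate_coeffs r m a)"
proof -
  assume a: "a \<in> Bset q"
  have "orbit (integer_mod_group r) (Bact q) a = (\<lambda>m. Bact q m a) ` {0..<int r}"
    by (auto simp: orbit_def carrier_mod)
  also have "\<dots> = (\<lambda>m. rotate_coeffs r m a) ` {0..<int r}"
    using a by (intro image_cong) (auto simp: Bact_eq)
  also have "\<dots> = range (\<lambda>m. rotate_coeffs r m a)"
  proof
    show "range (\<lambda>m. rotate_coeffs r m a) \<subseteq> (\<lambda>m. rotate_coeffs r m a) ` {0..<int r}"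
    proof
      fix b assume "b \<in> range (\<lambda>m. rotate_coeffs r m a)"
      then obtain m where "b = rotate_coeffs r (m mod int r) a" by (auto simp: rotate_coeffs_mod[OF ram_pos])
      then show "b \<in> (\<lambda>m. rotate_coeffs r m a) ` {0..<int r}" using ram_pos by auto
    qed
  qed auto
  finally show ?thesis .
qed

lemma Btop_eq: "Btop q = top_of_set (torus_set zeros levels)"
  by (simp add: Btop_def Bset_eq euclidean_product_topology)

text \<open>With \<open>r = 1\<close> all rotations are trivial, orbits are points, and windings
  range over all integer vectors on the levels.\<close>

sublocale cover: torus_quotient 1 zeros levels "Btop q" "\<lambda>a. a"
proof
  have "{x \<in> torus_set zeros levels. x \<in> U} = U" if "U \<subseteq> torus_set zeros levels" for U
    using that by auto
  then show "quotient_map (top_of_set (torus_set zeros levels)) (Btop q) (\<lambda>a. a)"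
    by (simp add: quotient_map_def Btop_eq)
  have "rotate_coeffs 1 m a = a" for m a
    using root_of_unity_eq_1_iff[of 1] by (simp add: rotate_coeffs_def)
  then show "a = b \<longleftrightarrow> (\<exists>m. b = rotate_coeffs 1 m a)" for a b by auto
qed (simp_all add: finite_levels levels_zeros_disjoint)

sublocale quotient: torus_quotient r zeros levels "Bquot q" "orbit (integer_mod_group r) (Bact q)"
proof
  show "quotient_map (top_of_set (torus_set zeros levels)) (Bquot q) (orbit (integer_mod_group r) (Bact q))"
    unfolding Bquot_def Btop_eq by (rule quotient_map_quotient_topology)
next
  fix a b assume "a \<in> torus_set zeros levels" "b \<in> torus_set zeros levels"
  then have ab: "a \<in> Bset q" "b \<in> Bset q" by (auto simp: Bset_eq)
  show "orbit (integer_mod_group r) (Bact q) a = orbit (integer_mod_group r) (Bact q) b \<longleftrightarrow>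
      (\<exists>m. b = rotate_coeffs r m a)"
    unfolding orbit_eq[OF ab(1)] orbit_eq[OF ab(2)]
  proof
    assume "range (\<lambda>m. rotate_coeffs r m a) = range (\<lambda>m. rotate_coeffs r m b)"
    moreover have "b \<in> range (\<lambda>m. rotate_coeffs r m b)"
      by (rule range_eqI[of _ _ 0]) (simp add: rotate_coeffs_0)
    ultimately show "\<exists>m. b = rotate_coeffs r m a" by auto
  next
    assume "\<exists>m. b = rotate_coeffs r m a"
    then obtain m where m: "b = rotate_coeffs r m a" by blast
    have "rotate_coeffs r n a = rotate_coeffs r (n - m) b" "rotate_coeffs r n b = rotate_coeffs r (n + m) a" for n
      unfolding m by (simp_all add: rotate_coeffs_add[symmetric])
    then show "range (\<lambda>m. rotate_coeffs r m a) = range (\<lambda>m. rotate_coeffs r m b)"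
      by (metis (no_types, lifting) image_subset_iff rangeI subset_antisym)
  qed
next
  show "int r dvd m" if "\<And>j. j \<in> levels \<Longrightarrow> int r dvd m * int j" for m
    using that by (rule levels_faithful)
qed (fact ram_pos finite_levels levels_zeros_disjoint)+

end

theorem mainTheorem20:
  fixes q :: "rat \<Rightarrow> complex"
  assumes "exp_factor q"
  shows "group_action (integer_mod_group (ram q)) (Bset q) (Bact q)
    \<and> (\<forall>m \<in> carrier (integer_mod_group (ram q)). \<forall>a \<in> Bset q. Bact q m a = a \<longrightarrow> m = 0)
    \<and> (\<forall>a \<in> Bset q.
          fundamental_group (Btop q) a \<cong> Zpow (card (Levels q))
        \<and> fundamental_group (Bquot q) (orbit (integer_mod_group (ram q)) (Bact q) a)
            \<cong> Zpow (card (Levels q))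
        \<and> (ram q > 1 \<longrightarrow>
            \<not> (\<exists>p s. p \<in> hom (fundamental_group (Bquot q) (orbit (integer_mod_group (ram q)) (Bact q) a))
                              (integer_mod_group (ram q))
                   \<and> s \<in> hom (integer_mod_group (ram q))
                              (fundamental_group (Bquot q) (orbit (integer_mod_group (ram q)) (Bact q) a))
                   \<and> (\<forall>x \<in> carrier (integer_mod_group (ram q)). p (s x) = x))))"
proof -
  interpret exponential_factor q by unfold_locales fact
  show ?thesis
  proof (intro conjI ballI impI notI)
    show "group_action (integer_mod_group (ram q)) (Bset q) (Bact q)"
      by (rule Bact_group_action)
    show "m = 0" if "m \<in> carrier (integer_mod_group (ram q))" "a \<in> Bset q" "Bact q m a = a" for m a
      using that by (rule Bact_free)
  next
    fix a assume a: "a \<in> Bset q"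
    then show "fundamental_group (Btop q) a \<cong> Zpow (card (Levels q))"
      unfolding card_Levels Bset_eq by (rule cover.fundamental_group_iso_Zpow)
    show iso: "fundamental_group (Bquot q) (orbit (integer_mod_group (ram q)) (Bact q) a)
        \<cong> Zpow (card (Levels q))"
      using a unfolding card_Levels Bset_eq by (rule quotient.fundamental_group_iso_Zpow)
    assume "ram q > 1"
      and "\<exists>p s. p \<in> hom (fundamental_group (Bquot q) (orbit (integer_mod_group (ram q)) (Bact q) a))
                              (integer_mod_group (ram q))
                   \<and> s \<in> hom (integer_mod_group (ram q))
                              (fundamental_group (Bquot q) (orbit (integer_mod_group (ram q)) (Bact q) a))
                   \<and> (\<forall>x \<in> carrier (integer_mod_group (ram q)). p (s x) = x)"
    then obtain p s where s: "s \<in> hom (integer_mod_group (ram q))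
        (fundamental_group (Bquot q) (orbit (integer_mod_group (ram q)) (Bact q) a))"
      and ps: "\<And>x. x \<in> carrier (integer_mod_group (ram q)) \<Longrightarrow> p (s x) = x"
      by blast
    \<comment> \<open>Since \<open>p\<close> is arbitrary, no homomorphism onto the cyclic group has
      a section, whichever map is taken as the projection of the sequence.\<close>
    have "s 1 = s 0" by (rule hom_integer_mod_group_trivial[OF iso \<open>ram q > 1\<close> s])
    moreover have "p (s 1) = 1" "p (s 0) = 0" using \<open>ram q > 1\<close> by (auto intro!: ps)
    ultimately show False by simp
  qed
qed

end
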